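(* Let $(\mathcal{A},\varphi)$ be a $C^*$-probability space with faithful tracial state $\varphi$. Let $\alpha,\lambda,\kappa>0$ with $\lambda+\kappa>1$, and let $X,Y\in\mathcal{A}$ be free self-adjoint elements having the free Poisson distributions $\mu(\alpha,\lambda)$ and $\mu(\alpha,\kappa)$, respectively. Then the random variables $$U=(X+Y)^{-1/2}X(X+Y)^{-1/2}\qquad\text{and}\qquad V=X+Y$$ are free.
   Context: Free Poisson (Marchenko–Pastur) distribution $\mu(\alpha,\lambda)$, $\alpha,\lambda>0$: $\mu=\max\{0,1-\lambda\}\delta_0+\tilde\mu$, where $\tilde\mu$ is supported on $(\alpha(1-\sqrt\lambda)^2,\alpha(1+\sqrt\lambda)^2)$ with density $\frac{1}{2\pi\alpha x}\sqrt{4\lambda\alpha^2-(x-\alpha(1+\lambda))^2}$. Since $\lambda+\kappa>1$ and $\varphi$ is faithful, $X+Y$ is positive and invertible, so $(X+Y)^{-1/2}\in\mathcal{A}$ is well defined. Freeness of $U$ and $V$ means freeness with respect to $\varphi$ of the unital subalgebras generated by $U$ and by $V$. *)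

theory Defs
  imports "HOL-Probability.Probability"
begin

section \<open>Unital C*-algebras\<close>

(* Completeness, submultiplicativity of the norm and "norm 1 = 1" (so the algebra is nonzero)
   come from the real Banach algebra superclasses. *)
class cstar_algebra = real_normed_algebra_1 + banach +
  fixes scaleC :: "complex \<Rightarrow> 'a \<Rightarrow> 'a"
    and adj :: "'a \<Rightarrow> 'a"
  assumes scaleC_add_right: "scaleC c (x + y) = scaleC c x + scaleC c y"
    and scaleC_add_left: "scaleC (c + d) x = scaleC c x + scaleC d x"
    and scaleC_scaleC: "scaleC c (scaleC d x) = scaleC (c * d) x"
    and scaleR_conv_scaleC: "scaleR r x = scaleC (complex_of_real r) x"
    and norm_scaleC: "norm (scaleC c x) = cmod c * norm x"
    and mult_scaleC_left: "scaleC c x * y = scaleC c (x * y)"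
    and mult_scaleC_right: "x * scaleC c y = scaleC c (x * y)"
    and adj_adj: "adj (adj x) = x"
    and adj_add: "adj (x + y) = adj x + adj y"
    and adj_scaleC: "adj (scaleC c x) = scaleC (cnj c) (adj x)"
    and adj_mult: "adj (x * y) = adj y * adj x"
    and cstar_identity: "norm (adj x * x) = (norm x)\<^sup>2"

instantiation complex :: cstar_algebra
begin

definition scaleC_complex :: "complex \<Rightarrow> complex \<Rightarrow> complex" where
  "scaleC_complex c x = c * x"

definition adj_complex :: "complex \<Rightarrow> complex" where
  "adj_complex = cnj"

instance
  by standard
    (simp_all add: scaleC_complex_def adj_complex_def algebra_simps scaleR_conv_of_real
      norm_mult power2_eq_square)

end

definition selfadjoint :: "'a::cstar_algebra \<Rightarrow> bool" where
  "selfadjoint x \<longleftrightarrow> adj x = x"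

definition cstar_positive :: "'a::cstar_algebra \<Rightarrow> bool" where
  "cstar_positive x \<longleftrightarrow> (\<exists>b. x = adj b * b)"

(* a^(-1/2): the positive element whose square is the two-sided inverse of a.  It exists and
   is unique when a is positive and invertible; for other a the value is not meaningful. *)
definition cstar_inv_sqrt :: "'a::cstar_algebra \<Rightarrow> 'a" where
  "cstar_inv_sqrt a = (THE s. cstar_positive s \<and> (s * s) * a = 1 \<and> a * (s * s) = 1)"

section \<open>States\<close>

definition state :: "('a::cstar_algebra \<Rightarrow> complex) \<Rightarrow> bool" where
  "state \<phi> \<longleftrightarrow>
     (\<forall>x y. \<phi> (x + y) = \<phi> x + \<phi> y) \<and> (\<forall>c x. \<phi> (scaleC c x) = c * \<phi> x) \<and>
     (\<forall>x. \<phi> (adj x * x) \<in> \<real>\<^sub>\<ge>\<^sub>0) \<and> \<phi> 1 = 1"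

definition faithful :: "('a::cstar_algebra \<Rightarrow> complex) \<Rightarrow> bool" where
  "faithful \<phi> \<longleftrightarrow> (\<forall>x. \<phi> (adj x * x) = 0 \<longrightarrow> x = 0)"

definition tracial :: "('a::cstar_algebra \<Rightarrow> complex) \<Rightarrow> bool" where
  "tracial \<phi> \<longleftrightarrow> (\<forall>x y. \<phi> (x * y) = \<phi> (y * x))"

section \<open>Freeness\<close>

definition unital_subalgebra :: "'a::cstar_algebra set \<Rightarrow> bool" where
  "unital_subalgebra B \<longleftrightarrow> 1 \<in> B \<and> (\<forall>x\<in>B. \<forall>y\<in>B. x + y \<in> B \<and> x * y \<in> B) \<and>
     (\<forall>c. \<forall>x\<in>B. scaleC c x \<in> B)"

(* A word is a list of pairs (index of the subalgebra, element of that subalgebra);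
   distinct_adj says that neighbouring indices differ. *)
definition free_family ::
  "('a::cstar_algebra \<Rightarrow> complex) \<Rightarrow> 'i set \<Rightarrow> ('i \<Rightarrow> 'a set) \<Rightarrow> bool" where
  "free_family \<phi> I B \<longleftrightarrow>
     (\<forall>w. w \<noteq> [] \<and> (\<forall>(i, a) \<in> set w. i \<in> I \<and> a \<in> B i \<and> \<phi> a = 0) \<and>
          distinct_adj (map fst w)
          \<longrightarrow> \<phi> (prod_list (map snd w)) = 0)"

definition free_pair :: "('a::cstar_algebra \<Rightarrow> complex) \<Rightarrow> 'a \<Rightarrow> 'a \<Rightarrow> bool" where
  "free_pair \<phi> x y \<longleftrightarrow>
     free_family \<phi> (UNIV :: bool set)
       (\<lambda>i. if i then unital_subalgebra hull {x} else unital_subalgebra hull {y})"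

section \<open>Distributions\<close>

(* The distribution of a selfadjoint element is the compactly supported Borel probability
   measure on the line having the same moments; compactness of the support makes it unique. *)
definition has_distribution ::
  "('a::cstar_algebra \<Rightarrow> complex) \<Rightarrow> 'a \<Rightarrow> real measure \<Rightarrow> bool" where
  "has_distribution \<phi> x \<mu> \<longleftrightarrow>
     sets \<mu> = sets borel \<and> prob_space \<mu> \<and> (\<exists>K. compact K \<and> emeasure \<mu> (- K) = 0) \<and>
     (\<forall>n. \<phi> (x ^ n) = complex_of_real (\<integral>t. t ^ n \<partial>\<mu>))"

definition free_poisson_density :: "real \<Rightarrow> real \<Rightarrow> real \<Rightarrow> real" where
  "free_poisson_density \<alpha> lam x =
     (if x \<in> {\<alpha> * (1 - sqrt lam)\<^sup>2 <..< \<alpha> * (1 + sqrt lam)\<^sup>2}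
      then 1 / (2 * pi * \<alpha> * x) * sqrt (4 * lam * \<alpha>\<^sup>2 - (x - \<alpha> * (1 + lam))\<^sup>2)
      else 0)"

definition free_poisson :: "real \<Rightarrow> real \<Rightarrow> real measure" where
  "free_poisson \<alpha> lam = measure_of UNIV (sets borel)
     (\<lambda>E. ennreal (max 0 (1 - lam)) * indicator E 0
          + emeasure (density lborel (\<lambda>x. ennreal (free_poisson_density \<alpha> lam x))) E)"

lemma sets_free_poisson [simp]: "sets (free_poisson \<alpha> lam) = sets borel"
  unfolding free_poisson_def using sets.sigma_sets_eq[of "borel :: real measure"]
  by (simp add: sets_measure_of_conv)

(* measure_of silently yields the null measure for a set function that is not a measure;
   this rules that out. *)
lemma emeasure_free_poisson:
  assumes "E \<in> sets borel"
  shows "emeasure (free_poisson \<alpha> lam) E =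
    ennreal (max 0 (1 - lam)) * indicator E 0
    + (\<integral>\<^sup>+x. ennreal (free_poisson_density \<alpha> lam x) * indicator E x \<partial>lborel)"
proof -
  define N where "N = density lborel (\<lambda>x. ennreal (free_poisson_density \<alpha> lam x))"
  define f where "f E = ennreal (max 0 (1 - lam)) * indicator E 0 + emeasure N E" for E
  have f_eq: "f E = ennreal (max 0 (1 - lam)) * emeasure (return borel 0) E + emeasure N E"
    if "E \<in> sets borel" for E
    using that by (simp add: f_def)
  have N: "sets N = sets borel" by (simp add: N_def)
  have meas: "(\<lambda>x. ennreal (free_poisson_density \<alpha> lam x)) \<in> borel_measurable lborel"
    unfolding free_poisson_density_def by measurable
  have "emeasure (free_poisson \<alpha> lam) E = f E"
  proof (rule emeasure_measure_of[OF _ _ _ _ ])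
    show "free_poisson \<alpha> lam = measure_of UNIV (sets borel) f"
      by (simp add: free_poisson_def f_def[abs_def] N_def)
    show "positive (sets (free_poisson \<alpha> lam)) f"
      by (simp add: positive_def f_def)
    show "countably_additive (sets (free_poisson \<alpha> lam)) f"
    proof (rule countably_additiveI)
      fix A :: "nat \<Rightarrow> real set"
      assume "range A \<subseteq> sets (free_poisson \<alpha> lam)" and disj: "disjoint_family A"
      then have A: "range A \<subseteq> sets borel" by simp
      have "(\<Sum>i. f (A i)) =
          (\<Sum>i. ennreal (max 0 (1 - lam)) * emeasure (return borel 0) (A i) + emeasure N (A i))"
        using A by (intro suminf_cong f_eq) auto
      also have "\<dots> = ennreal (max 0 (1 - lam)) * (\<Sum>i. emeasure (return borel 0) (A i))
          + (\<Sum>i. emeasure N (A i))"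
        by (subst suminf_add[symmetric]) (simp_all add: ennreal_suminf_cmult)
      also have "\<dots> = f (\<Union>i. A i)"
        using A disj N by (subst (1 2) suminf_emeasure) (auto simp: f_def image_subset_iff)
      finally show "(\<Sum>i. f (A i)) = f (\<Union>i. A i)" .
    qed
  qed (use assms in auto)
  then show ?thesis
    using assms meas by (simp add: f_def N_def emeasure_density)
qed

end

theory Submission
  imports Defs
begin

text \<open>Put \<open>V = X + Y\<close> and \<open>W = V\<^sup>-\<^sup>1 X\<close>.  Since \<open>U = V\<^sup>1\<^sup>/\<^sup>2 W V\<^sup>-\<^sup>1\<^sup>/\<^sup>2\<close>, conjugation by
  \<open>V\<^sup>1\<^sup>/\<^sup>2\<close>, which fixes \<open>V\<close>, reduces the freeness of \<open>U\<close> and \<open>V\<close> to that of \<open>W\<close> and \<open>V\<close>.  Let \<open>D\<close> be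
  the derivation into the tensor square with \<open>D X = 1 \<otimes> X\<close> and \<open>D Y = 1 \<otimes> Y\<close>.  The moment recursion
  of the free Poisson laws and the freeness of \<open>X\<close> and \<open>Y\<close> give the Schwinger-Dyson equation
  \<open>\<phi> (V P) = \<alpha> (\<lambda> + \<kappa>) \<phi> P + \<alpha> (\<phi> \<otimes> \<phi>) (D P)\<close>.  As \<open>D V = 1 \<otimes> V\<close> and \<open>D W = 0\<close>, this is the
  Schwinger-Dyson equation of a free Poisson element \<open>V\<close> that is free from \<open>W\<close>, and it determines the
  joint moments.  Invertibility of \<open>V\<close> comes from its moments: they are those of a law supported away
  from 0, and in the presence of a faithful trace the growth of the moments bounds the norm.\<close>

section \<open>Square roots in C*-algebras\<close>

text \<open>The shape of D reflects the free cumulants \<lambda> \<alpha>^n. In a noncrossing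
  partition of a word that begins with X, the block of this X is either a singleton, of weight
  \<alpha> \<lambda>, or it has a next member. In the second case deleting the X costs one factor
  \<alpha> and cuts the rest just before that member, which stays on the right: hence
  \<open>1 \<otimes> X\<close> and not \<open>1 \<otimes> 1\<close>. Because \<alpha> is common to X
  and Y, the derivations of the two letters add up to one. The detour through W is taken because D
  of an inverse has a closed form, while D of the noncommutative root V^(-1/2) has none. Still,
  V^(-1) is only a norm limit of polynomials, and D may fail to be well defined on elements, since
  different polynomials can name the same one; therefore elements carry their derivative along, and
  limits are taken in its bilinear form. With \<theta> = \<lambda> + \<kappa>, the law of V has
  centre \<alpha> (1 + \<theta>) and half-width 2 \<alpha> sqrt \<theta>. Their difference \<alpha>
  (1 - sqrt \<theta>)^2 is positive as \<theta> > 1, so V is close enough to a multiple of 1 for a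
  Neumann series.\<close>

lemma scaleC_one [simp]: "scaleC 1 x = (x::'a::cstar_algebra)"
  using scaleR_conv_scaleC[of 1 x] by simp

lemma scaleC_zero_left [simp]: "scaleC 0 x = (0::'a::cstar_algebra)"
  using scaleR_conv_scaleC[of 0 x] by simp

lemma scaleC_zero_right [simp]: "scaleC c 0 = (0::'a::cstar_algebra)"
  using norm_scaleC[of c "0::'a"] by simp

lemma scaleC_minus_one: "scaleC (-1) x = - (x::'a::cstar_algebra)"
  using scaleR_conv_scaleC[of "-1" x] by simp

lemma adj_zero [simp]: "adj 0 = (0::'a::cstar_algebra)"
  using adj_scaleC[of 0 "0::'a"] by simp

lemma adj_scaleR: "adj (scaleR r x) = scaleR r (adj (x::'a::cstar_algebra))"
  by (simp add: scaleR_conv_scaleC adj_scaleC)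

lemma adj_minus: "adj (- x) = - adj (x::'a::cstar_algebra)"
  using adj_scaleR[of "-1" x] by simp

lemma adj_diff: "adj (x - y) = adj x - adj (y::'a::cstar_algebra)"
  using adj_add[of x "- y"] by (simp add: adj_minus)

lemma adj_one [simp]: "adj 1 = (1::'a::cstar_algebra)"
  using adj_mult[of "adj 1" "1::'a"] by (simp add: adj_adj)

lemma adj_power: "adj (x ^ n) = adj (x::'a::cstar_algebra) ^ n"
  by (induction n) (simp_all add: adj_mult power_commutes)

lemma norm_adj [simp]: "norm (adj x) = norm (x::'a::cstar_algebra)"
proof -
  have le: "norm x \<le> norm (adj x)" for x :: 'a
  proof (cases "x = 0")
    case False
    have "norm x * norm x \<le> norm (adj x) * norm x"
      using norm_mult_ineq[of "adj x" x] cstar_identity[of x] by (simp add: power2_eq_square)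
    with False show ?thesis by simp
  qed simp
  from le[of x] le[of "adj x"] show ?thesis by (simp add: adj_adj)
qed

lemma bounded_linear_adj: "bounded_linear (adj :: 'a::cstar_algebra \<Rightarrow> 'a)"
  by (rule bounded_linear_intro[where K = 1]) (simp_all add: adj_add adj_scaleR)

lemma norm_square_selfadjoint:
  "selfadjoint x \<Longrightarrow> norm (x * x) = (norm (x::'a::cstar_algebra))\<^sup>2"
  using cstar_identity[of x] by (simp add: selfadjoint_def)

lemma selfadjoint_add: "selfadjoint x \<Longrightarrow> selfadjoint y \<Longrightarrow> selfadjoint (x + y)"
  by (simp add: selfadjoint_def adj_add)

lemma selfadjoint_diff: "selfadjoint x \<Longrightarrow> selfadjoint y \<Longrightarrow> selfadjoint (x - y)"
  by (simp add: selfadjoint_def adj_diff)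

lemma selfadjoint_scaleR: "selfadjoint x \<Longrightarrow> selfadjoint (scaleR r x)"
  by (simp add: selfadjoint_def adj_scaleR)

lemma selfadjoint_one: "selfadjoint 1"
  by (simp add: selfadjoint_def)

lemma selfadjoint_of_real: "selfadjoint (of_real r)"
  by (simp add: of_real_def selfadjoint_scaleR selfadjoint_one)

lemma selfadjoint_commuting_mult:
  "selfadjoint x \<Longrightarrow> selfadjoint y \<Longrightarrow> x * y = y * x \<Longrightarrow> selfadjoint (x * y)"
  by (simp add: selfadjoint_def adj_mult)

text \<open>The Taylor coefficients of \<open>1 - sqrt (1 - u)\<close>, shifted by one: the recursion is the
  fixed point equation \<open>2 f = u + f\<^sup>2\<close>.\<close>

fun sqrt_coeff :: "nat \<Rightarrow> real" where
  "sqrt_coeff 0 = 1 / 2"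
| "sqrt_coeff (Suc n) = (\<Sum>i\<le>n. sqrt_coeff i * sqrt_coeff (n - i)) / 2"

lemma sqrt_coeff_nonneg: "sqrt_coeff n \<ge> 0"
proof (induction n rule: less_induct)
  case (less n)
  show ?case
  proof (cases n)
    case (Suc m)
    then have "0 \<le> (\<Sum>i\<le>m. sqrt_coeff i * sqrt_coeff (m - i))"
      by (intro sum_nonneg mult_nonneg_nonneg less) auto
    with Suc show ?thesis by simp
  qed simp
qed

text \<open>The recursion bounds each partial sum by (1 + s^2) / 2, where s is the preceding one,
  and 1 is the fixed point of that map.\<close>

lemma sum_sqrt_coeff_le: "(\<Sum>k<n. sqrt_coeff k) \<le> 1"
proof (induction n)
  case (Suc n)
  let ?c = sqrt_coeff
  have "(\<Sum>k<Suc n. ?c k) = 1 / 2 + (\<Sum>m<n. ?c (Suc m))"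
    by (subst sum.lessThan_Suc_shift) simp
  also have "(\<Sum>m<n. ?c (Suc m)) = (\<Sum>m<n. \<Sum>i\<le>m. ?c i * ?c (m - i)) / 2"
    by (simp add: sum_divide_distrib)
  also have "(\<Sum>m<n. \<Sum>i\<le>m. ?c i * ?c (m - i)) = (\<Sum>(i, j)\<in>{(i, j). i + j < n}. ?c i * ?c j)"
    by (rule sum.triangle_reindex[symmetric])
  also have "\<dots> \<le> (\<Sum>(i, j)\<in>{..<n} \<times> {..<n}. ?c i * ?c j)"
    by (rule sum_mono2) (auto simp: sqrt_coeff_nonneg)
  also have "\<dots> = (\<Sum>k<n. ?c k) * (\<Sum>k<n. ?c k)"
    by (simp add: sum_product sum.cartesian_product)
  also have "\<dots> \<le> 1"
    using Suc by (intro mult_le_one sum_nonneg) (auto simp: sqrt_coeff_nonneg)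
  finally show ?case by simp
qed simp

lemma summable_sqrt_coeff: "summable sqrt_coeff"
  by (rule summableI_nonneg_bounded[where x = 1]) (auto simp: sqrt_coeff_nonneg sum_sqrt_coeff_le)

text \<open>The root is 1 - f with f the series in u = 1 - y. Its coefficients are summable, so norm
  1 is allowed and y need not be invertible. The commutation clause stands in for functional
  calculus: roots of commuting elements can be iterated and still commute.\<close>

lemma selfadjoint_sqrt:
  fixes y :: "'a::cstar_algebra"
  assumes "selfadjoint y" "norm (1 - y) \<le> 1"
  obtains g where "selfadjoint g" "g * g = y" "norm (1 - g) \<le> 1"
    "\<And>t. t * y = y * t \<Longrightarrow> t * g = g * t"
proof -
  define u where "u = 1 - y"
  define F where "F k = scaleR (sqrt_coeff k) (u ^ Suc k)" for k
  define f where "f = suminf F"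
  have un: "norm (u ^ k) \<le> 1" for k
  proof -
    have "norm (u ^ k) \<le> norm u ^ k" by (rule norm_power_ineq)
    also have "\<dots> \<le> 1" using assms by (intro power_le_one) (auto simp: u_def)
    finally show ?thesis .
  qed
  have nF: "norm (F k) \<le> sqrt_coeff k" for k
    using un[of "Suc k"] sqrt_coeff_nonneg[of k]
    by (simp add: F_def mult_left_le del: power_Suc)
  have sn: "summable (\<lambda>k. norm (F k))"
    by (rule summable_comparison_test[OF _ summable_sqrt_coeff]) (use nF in auto)
  then have sF: "summable F" by (rule summable_norm_cancel)
  have "norm f \<le> (\<Sum>k. norm (F k))"
    unfolding f_def by (rule summable_norm[OF sn])
  also have "\<dots> \<le> (\<Sum>k. sqrt_coeff k)"
    by (rule suminf_le[OF nF sn summable_sqrt_coeff])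
  also have "\<dots> \<le> 1"
    by (rule suminf_le_const[OF summable_sqrt_coeff sum_sqrt_coeff_le])
  finally have nf: "norm f \<le> 1" .
  have FF: "(\<Sum>i\<le>k. F i * F (k - i)) = scaleR 2 (F (Suc k))" for k
  proof -
    have "F i * F (k - i) = scaleR (sqrt_coeff i * sqrt_coeff (k - i)) (u ^ Suc (Suc k))"
      if "i \<le> k" for i
    proof -
      have "u ^ Suc i * u ^ Suc (k - i) = u ^ Suc (Suc k)"
        using that by (simp only: power_add[symmetric]) simp
      then show ?thesis by (simp add: F_def del: power_Suc)
    qed
    then have "(\<Sum>i\<le>k. F i * F (k - i))
      = (\<Sum>i\<le>k. scaleR (sqrt_coeff i * sqrt_coeff (k - i)) (u ^ Suc (Suc k)))"
      by (intro sum.cong) auto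
    then show ?thesis by (simp add: F_def scaleR_sum_left[symmetric] del: power_Suc)
  qed
  have "f * f = (\<Sum>k. \<Sum>i\<le>k. F i * F (k - i))"
    unfolding f_def by (rule Cauchy_product[OF sn sn])
  also have "\<dots> = scaleR 2 (\<Sum>k. F (Suc k))"
    unfolding FF using sF by (simp add: suminf_scaleR_right summable_Suc_iff)
  also have "(\<Sum>k. F (Suc k)) = f - F 0"
    unfolding f_def by (rule suminf_minus_initial_segment[OF sF, of 1, simplified])
  finally have ff: "f * f = scaleR 2 f - u"
    by (simp add: F_def scaleR_diff_right)
  have "adj u = u" using assms(1) by (simp add: u_def selfadjoint_def adj_diff)
  then have "adj (F k) = F k" for k
    by (simp add: F_def adj_scaleR adj_power del: power_Suc)
  then have "adj f = f"
    unfolding f_def using bounded_linear.suminf[OF bounded_linear_adj sF] by simp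
  have comm: "t * f = f * t" if "t * y = y * t" for t
  proof -
    have "t * u = u * t" using that by (simp add: u_def algebra_simps)
    then have "t * u ^ k = u ^ k * t" for k
      by (rule power_commuting_commutes[symmetric, OF sym])
    then have "t * F k = F k * t" for k by (simp add: F_def del: power_Suc)
    then show ?thesis
      unfolding f_def using suminf_mult[OF sF, of t] suminf_mult2[OF sF, of t] by simp
  qed
  show ?thesis
  proof
    show "selfadjoint (1 - f)" using \<open>adj f = f\<close> by (simp add: selfadjoint_def adj_diff)
    show "(1 - f) * (1 - f) = y" using ff by (simp add: algebra_simps u_def scaleR_2)
    show "norm (1 - (1 - f)) \<le> 1" using nf by simp
    show "t * (1 - f) = (1 - f) * t" if "t * y = y * t" for t
      using comm[OF that] by (simp add: algebra_simps)
  qed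
qed

text \<open>After division by M the preceding root applies to 1 - y / M. Inequalities between
  selfadjoint elements enter later in this form, as explicit squares.\<close>

lemma selfadjoint_sqrt_of_real_diff:
  fixes y :: "'a::cstar_algebra"
  assumes "selfadjoint y" "norm y \<le> M"
  obtains d where "selfadjoint d" "d * d = of_real M - y" "\<And>t. t * y = y * t \<Longrightarrow> t * d = d * t"
proof (cases "M = 0")
  case True
  with assms have "y = 0" by simp
  with True that[of 0] show ?thesis by (simp add: selfadjoint_def)
next
  case False
  with assms have M: "M > 0" using norm_ge_zero[of y] by linarith
  have "norm (1 - (1 - scaleR (1 / M) y)) \<le> 1" using M assms by simp
  then obtain g where g: "selfadjoint g" "g * g = 1 - scaleR (1 / M) y"
    "\<And>t. t * (1 - scaleR (1 / M) y) = (1 - scaleR (1 / M) y) * t \<Longrightarrow> t * g = g * t"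
    using selfadjoint_sqrt[of "1 - scaleR (1 / M) y"] assms
    by (metis selfadjoint_diff selfadjoint_one selfadjoint_scaleR)
  have gg: "t * g = g * t" if "t * y = y * t" for t
    by (rule g(3)) (simp add: algebra_simps that)
  show ?thesis
  proof
    show "selfadjoint (scaleR (sqrt M) g)" by (simp add: selfadjoint_scaleR g)
    show "scaleR (sqrt M) g * scaleR (sqrt M) g = of_real M - y"
      using M by (simp add: g(2) scaleR_diff_right of_real_def)
    show "t * scaleR (sqrt M) g = scaleR (sqrt M) g * t" if "t * y = y * t" for t
      using gg[OF that] by simp
  qed
qed

text \<open>\<open>x + \<i> b\<close> is \<open>sqrt r\<close> times a unitary, and \<open>x\<close> is its real part.\<close>

lemma norm_le_of_sum_squares:
  fixes x b :: "'a::cstar_algebra"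
  assumes "selfadjoint x" "selfadjoint b" "x * b = b * x" "x * x + b * b = of_real (r\<^sup>2)" "r \<ge> 0"
  shows "norm x \<le> r"
proof -
  define u where "u = x + scaleC \<i> b"
  have au: "adj u = x + scaleC (- \<i>) b"
    using assms by (simp add: u_def adj_add adj_scaleC selfadjoint_def)
  have "adj u * u = x * x + b * b + (scaleC \<i> (x * b) + scaleC (- \<i>) (b * x))"
    unfolding au unfolding u_def
    by (simp add: distrib_left distrib_right mult_scaleC_left mult_scaleC_right scaleC_scaleC
        scaleC_add_right add_ac)
  also have "\<dots> = x * x + b * b"
    using assms(3) by (simp add: scaleC_add_left[symmetric])
  finally have "adj u * u = x * x + b * b" .
  then have "(norm u)\<^sup>2 = norm (of_real (r\<^sup>2) :: 'a)" using cstar_identity[of u] assms(4) by simp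
  then have "norm u = r" using assms(5) by (simp add: norm_of_real del: of_real_power)
  moreover have "scaleC (- \<i>) b = - scaleC \<i> b"
    by (simp add: eq_neg_iff_add_eq_0 scaleC_add_left[symmetric])
  then have "u + adj u = scaleR 2 x" unfolding au unfolding u_def by (simp add: scaleR_2)
  then have "2 * norm x = norm (u + adj u)" by simp
  ultimately show ?thesis using norm_triangle_ineq[of u "adj u"] by simp
qed

section \<open>Tracial states and the norm\<close>

locale cstar_state =
  fixes \<phi> :: "'a::cstar_algebra \<Rightarrow> complex"
  assumes state: "state \<phi>"
begin

lemma phi_add: "\<phi> (x + y) = \<phi> x + \<phi> y"
  and phi_scaleC: "\<phi> (scaleC c x) = c * \<phi> x"
  and phi_adj_mult: "\<phi> (adj x * x) \<in> \<real>\<^sub>\<ge>\<^sub>0"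
  and phi_one: "\<phi> 1 = 1"
  using state by (auto simp: state_def)

lemma phi_zero: "\<phi> 0 = 0"
  using phi_add[of 0 0] by simp

lemma phi_minus: "\<phi> (- x) = - \<phi> x"
  using phi_scaleC[of "-1" x] by (simp add: scaleC_minus_one)

lemma phi_diff: "\<phi> (x - y) = \<phi> x - \<phi> y"
  using phi_add[of x "- y"] by (simp add: phi_minus)

lemma phi_scaleR: "\<phi> (scaleR r x) = of_real r * \<phi> x"
  by (simp add: scaleR_conv_scaleC phi_scaleC)

lemma phi_of_real: "\<phi> (of_real r) = of_real r"
  by (simp add: of_real_def phi_scaleR phi_one)

lemma phi_square: "selfadjoint x \<Longrightarrow> \<phi> (x * x) \<in> \<real>\<^sub>\<ge>\<^sub>0"
  using phi_adj_mult[of x] by (simp add: selfadjoint_def)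

text \<open>\<open>of_real (norm x) - x\<close> is a square, and a state is nonnegative on squares.
  This gives reality as well, which the definition of a state does not contain.\<close>

lemma phi_selfadjoint:
  assumes "selfadjoint x"
  shows "\<phi> x \<in> \<real>" "Re (\<phi> x) \<le> norm x"
proof -
  obtain d where d: "selfadjoint d" "d * d = of_real (norm x) - x"
    using selfadjoint_sqrt_of_real_diff[OF assms order_refl] by blast
  have "\<phi> x = of_real (norm x) - \<phi> (d * d)"
    by (simp add: d phi_diff phi_of_real)
  with phi_square[OF d(1)] show "\<phi> x \<in> \<real>" "Re (\<phi> x) \<le> norm x"
    by (auto simp: complex_nonneg_Reals_iff complex_is_Real_iff)
qed

lemma norm_phi_selfadjoint: "selfadjoint x \<Longrightarrow> cmod (\<phi> x) \<le> norm x"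
  using phi_selfadjoint[of x] phi_selfadjoint[of "- x"]
  by (auto simp: selfadjoint_def adj_minus phi_minus complex_is_Real_iff cmod_def)

text \<open>The optimal constant is 1; the factor 2 comes from splitting into real and imaginary part.\<close>

lemma norm_phi_le: "cmod (\<phi> x) \<le> 2 * norm x"
proof -
  define p q where "p = x + adj x" and "q = scaleC \<i> x + adj (scaleC \<i> x)"
  have sa: "selfadjoint p" "selfadjoint q"
    by (simp_all add: p_def q_def selfadjoint_def adj_add adj_adj add.commute)
  have "p + scaleC (- \<i>) q = scaleC 2 x"
    by (simp add: p_def q_def adj_scaleC scaleC_add_right scaleC_scaleC scaleC_minus_one
        scaleC_add_left[of 1 1, simplified])
  then have "2 * \<phi> x = \<phi> p + (- \<i>) * \<phi> q" by (metis phi_add phi_scaleC)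
  then have "2 * cmod (\<phi> x) = cmod (\<phi> p + (- \<i>) * \<phi> q)" by (metis norm_mult norm_numeral)
  also have "\<dots> \<le> cmod (\<phi> p) + cmod (\<phi> q)"
    using norm_triangle_ineq[of "\<phi> p" "(- \<i>) * \<phi> q"] by (simp add: norm_mult)
  also have "\<dots> \<le> norm p + norm q"
    by (intro add_mono norm_phi_selfadjoint sa)
  also have "\<dots> \<le> 4 * norm x"
    using norm_triangle_ineq[of x "adj x"] norm_triangle_ineq[of "scaleC \<i> x" "adj (scaleC \<i> x)"]
    by (simp add: p_def q_def norm_scaleC)
  finally show ?thesis by simp
qed

lemma bounded_linear_phi: "bounded_linear \<phi>"
  by (rule bounded_linear_intro[where K = 2])
    (use norm_phi_le in \<open>simp_all add: phi_add phi_scaleR scaleR_conv_of_real[where 'a = complex] mult.commute\<close>)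

end

locale tracial_state = cstar_state +
  assumes tracial: "tracial \<phi>"
begin

lemma phi_commute: "\<phi> (x * y) = \<phi> (y * x)"
  using tracial by (simp add: tracial_def)

end

locale faithful_tracial_state = tracial_state +
  assumes faithful: "faithful \<phi>"
begin

lemma selfadjoint_eq_0: "selfadjoint x \<Longrightarrow> \<phi> (x * x) = 0 \<Longrightarrow> x = 0"
  using faithful by (auto simp: faithful_def selfadjoint_def)

text \<open>The moments of \<open>x\<close> in the vector state of \<open>b\<close> grow no faster than those in \<open>\<phi>\<close>, because
  \<open>\<phi> (b\<^sup>* x\<^sup>2\<^sup>n b) = \<phi> (x\<^sup>n b b\<^sup>* x\<^sup>n)\<close>.\<close>

lemma moment_growth_vector_state:
  assumes x: "selfadjoint x" and b: "selfadjoint b" and r: "r > 0"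
    and growth: "\<And>n. Re (\<phi> (x ^ (2 * n))) \<le> C * (r\<^sup>2) ^ n"
  shows "Re (\<phi> (b * (x * x) * b)) \<le> r\<^sup>2 * Re (\<phi> (b * b))"
proof -
  define s where "s n = Re (\<phi> (b * x ^ (2 * n) * b))" for n
  define \<rho> where "\<rho> = r\<^sup>2"
  define K where "K = (norm b)\<^sup>2 * C"
  have \<rho>: "\<rho> > 0" using r by (simp add: \<rho>_def)
  \<comment> \<open>\<open>of_real ((norm b)\<^sup>2) - b * b\<close> is a square
    \<open>d * d\<close>; the trace brings \<open>b * b\<close> to one side of the power of x, where
    it can be replaced by its norm.\<close>
  have upper: "s n \<le> K * \<rho> ^ n" for n
  proof -
    have "selfadjoint (b * b)" using b by (simp add: selfadjoint_def adj_mult)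
    then obtain d where d: "selfadjoint d" "d * d = of_real ((norm b)\<^sup>2) - b * b"
      using selfadjoint_sqrt_of_real_diff[of "b * b" "(norm b)\<^sup>2"] norm_square_selfadjoint[OF b]
      by (metis order_refl)
    have xn: "adj (x ^ n) = x ^ n" using x by (simp add: selfadjoint_def adj_power)
    have "x ^ (2 * n) = x ^ n * x ^ n" by (simp add: power_add[symmetric] mult_2)
    have "\<phi> (adj (d * x ^ n) * (d * x ^ n)) = \<phi> (x ^ n * (d * d) * x ^ n)"
      using d(1) by (simp add: adj_mult xn selfadjoint_def mult.assoc)
    also have "\<dots> = \<phi> ((d * d) * x ^ n * x ^ n)"
      using phi_commute[of "x ^ n" "d * d * x ^ n"] by (simp only: mult.assoc)
    also have "\<dots> = of_real ((norm b)\<^sup>2) * \<phi> (x ^ (2 * n)) - \<phi> (b * b * x ^ (2 * n))"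
      unfolding d(2) by (simp add: \<open>x ^ (2 * n) = _\<close> left_diff_distrib mult.assoc phi_diff
          of_real_def phi_scaleR del: of_real_power)
    also have "\<phi> (b * b * x ^ (2 * n)) = \<phi> (b * x ^ (2 * n) * b)"
      using phi_commute[of b "b * x ^ (2 * n)"] by (simp add: mult.assoc)
    finally have "s n \<le> (norm b)\<^sup>2 * Re (\<phi> (x ^ (2 * n)))"
      using phi_adj_mult[of "d * x ^ n"]
      by (auto simp: s_def complex_nonneg_Reals_iff simp del: of_real_power)
    also have "\<dots> \<le> (norm b)\<^sup>2 * (C * (r\<^sup>2) ^ n)"
      by (intro mult_left_mono growth) simp
    finally show ?thesis by (simp add: K_def \<rho>_def)
  qed
  \<comment> \<open>This is the defect from geometric growth. Positivity of the square of
    \<open>x * x - of_real \<rho>\<close> makes it grow at least by the factor \<rho>, so a positive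
    \<open>d 0\<close> would force growth of order n \<rho>^n on s, against
    \<open>upper\<close>.\<close>
  define d where "d n = s (Suc n) - \<rho> * s n" for n
  have step: "d (Suc n) \<ge> \<rho> * d n" for n
  proof -
    define y where "y = (x * x - of_real \<rho>) * x ^ n * b"
    have ay: "adj y = b * x ^ n * (x * x - of_real \<rho>)"
      using x b selfadjoint_of_real[of \<rho>, where 'a = 'a]
      by (simp add: y_def adj_mult adj_diff adj_power selfadjoint_def mult.assoc)
    have expand: "a * ((t - s) * (t - s)) * c
        = a * (t * t) * c - (a * (t * s) * c + a * (s * t) * c) + a * (s * s) * c"
      for a c s t :: 'a by (simp only: algebra_simps)
    have pow: "(b * x ^ n) * x ^ k * (x ^ n * b) = b * x ^ (n + k + n) * b" for k
      by (simp only: power_add mult.assoc)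
    have "adj y * y = (b * x ^ n) * ((x * x - of_real \<rho>) * (x * x - of_real \<rho>)) * (x ^ n * b)"
      unfolding ay unfolding y_def by (simp only: mult.assoc)
    also have "\<dots> = (b * x ^ n) * x ^ 4 * (x ^ n * b) - (2 * \<rho>) *\<^sub>R ((b * x ^ n) * x ^ 2 * (x ^ n * b))
        + (\<rho> * \<rho>) *\<^sub>R ((b * x ^ n) * x ^ 0 * (x ^ n * b))"
      unfolding expand
      by (simp add: of_real_def scaleR_add_left[symmetric] power_numeral_reduce mult.assoc)
    also have "\<dots> = b * x ^ (2 * Suc (Suc n)) * b - (2 * \<rho>) *\<^sub>R (b * x ^ (2 * Suc n) * b)
        + (\<rho> * \<rho>) *\<^sub>R (b * x ^ (2 * n) * b)"
    proof -
      have "n + 4 + n = 2 * Suc (Suc n)" "n + 2 + n = 2 * Suc n" "n + 0 + n = 2 * n" by simp_all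
      then show ?thesis unfolding pow by (simp only:)
    qed
    finally have "Re (\<phi> (adj y * y)) = s (Suc (Suc n)) - 2 * \<rho> * s (Suc n) + \<rho> * \<rho> * s n"
      by (simp add: s_def phi_add phi_diff phi_scaleR del: power_Suc mult_Suc_right)
    moreover have "Re (\<phi> (adj y * y)) \<ge> 0"
      using phi_adj_mult[of y] by (simp add: complex_nonneg_Reals_iff)
    ultimately show ?thesis by (simp add: d_def algebra_simps)
  qed
  have dn: "d n \<ge> \<rho> ^ n * d 0" for n
  proof (induction n)
    case (Suc n)
    have "\<rho> ^ Suc n * d 0 = \<rho> * (\<rho> ^ n * d 0)" by simp
    also have "\<dots> \<le> \<rho> * d n" using Suc \<rho> by (intro mult_left_mono) auto
    also have "\<dots> \<le> d (Suc n)" by (rule step)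
    finally show ?case .
  qed simp
  have s0: "s 0 \<ge> 0"
    using phi_square[OF b] by (simp add: s_def complex_nonneg_Reals_iff)
  \<comment> \<open>The natural bound has exponent n - 1; the extra factor \<rho> on the left avoids
    the truncated subtraction at 0.\<close>
  have lower: "\<rho> * s n \<ge> real n * \<rho> ^ n * d 0" for n
  proof (induction n)
    case 0
    then show ?case using s0 \<rho> by simp
  next
    case (Suc n)
    have "s (Suc n) = \<rho> * s n + d n" by (simp add: d_def)
    then have "s (Suc n) \<ge> real (Suc n) * \<rho> ^ n * d 0"
      using Suc dn[of n] by (simp add: algebra_simps)
    then have "\<rho> * (real (Suc n) * \<rho> ^ n * d 0) \<le> \<rho> * s (Suc n)"
      using \<rho> by (intro mult_left_mono) auto
    then show ?case by (simp add: mult_ac)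
  qed
  have "d 0 \<le> 0"
  proof (rule ccontr)
    assume "\<not> d 0 \<le> 0"
    then have d0: "d 0 > 0" by simp
    obtain n :: nat where n: "real n > \<rho> * K / d 0" using reals_Archimedean2 by blast
    have "\<rho> * s n \<le> \<rho> * (K * \<rho> ^ n)"
      using \<rho> by (intro mult_left_mono upper) simp
    with lower[of n] have "real n * \<rho> ^ n * d 0 \<le> \<rho> * (K * \<rho> ^ n)" by linarith
    then have "real n * d 0 * \<rho> ^ n \<le> \<rho> * K * \<rho> ^ n" by (simp add: mult_ac)
    then have "real n * d 0 \<le> \<rho> * K" using \<rho> by simp
    with n d0 show False by (simp add: field_simps)
  qed
  then show ?thesis by (simp add: d_def s_def \<rho>_def power2_eq_square)
qed

text \<open>With \<open>z = r\<^sup>2 - x\<^sup>2\<close> and \<open>f = \<bar>z\<bar> - z\<close>, the vector state of \<open>f\<close> is nonnegative on \<open>z\<close>,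
  whereas \<open>f z f = - f \<bar>z\<bar> f\<close>; hence \<open>f = 0\<close> and \<open>z\<close> is a square.\<close>

lemma norm_le_of_moment_growth:
  assumes x: "selfadjoint x" and r: "r > 0"
    and growth: "\<And>n. Re (\<phi> (x ^ (2 * n))) \<le> C * (r\<^sup>2) ^ n"
  shows "norm x \<le> r"
proof -
  define z where "z = of_real (r\<^sup>2) - x * x"
  have xx: "selfadjoint (x * x)" using x by (simp add: selfadjoint_def adj_mult)
  have z: "selfadjoint z"
    unfolding z_def by (intro selfadjoint_diff xx selfadjoint_of_real)
  define M where "M = norm z + 1"
  have M: "M > 0" by (simp add: M_def add_nonneg_pos)
  define y where "y = scaleR (1 / M) z"
  have y: "selfadjoint y" unfolding y_def by (rule selfadjoint_scaleR[OF z])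
  have yy: "selfadjoint (y * y)" using y by (simp add: selfadjoint_def adj_mult)
  have ny: "norm y \<le> 1" using M by (simp add: y_def M_def)
  then have "norm (y * y) \<le> 1" by (simp add: norm_square_selfadjoint[OF y] power_le_one)
  \<comment> \<open>Here w = sqrt (1 - y^2) serves only to show that 1 - y^2 has norm at most 1, the
    condition for extracting m = |y| from y^2. The further root g of m turns
    \<open>f * m * f\<close> into the square of \<open>g * f\<close>.\<close>
  then obtain w where w: "selfadjoint w" "w * w = of_real 1 - y * y"
      "\<And>t. t * (y * y) = (y * y) * t \<Longrightarrow> t * w = w * t"
    using selfadjoint_sqrt_of_real_diff[OF yy, of 1] by metis
  have "norm w \<le> 1"
    using w(3)[of y] by (intro norm_le_of_sum_squares[OF w(1) y]) (simp_all add: w(2) mult.assoc)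
  then have "norm (1 - y * y) \<le> 1"
    using w(2) norm_square_selfadjoint[OF w(1)] by (simp add: power_le_one)
  then obtain m where m: "selfadjoint m" "m * m = y * y" "norm (1 - m) \<le> 1"
      "\<And>t. t * (y * y) = (y * y) * t \<Longrightarrow> t * m = m * t"
    using selfadjoint_sqrt[OF yy] by metis
  obtain g where g: "selfadjoint g" "g * g = m" "\<And>t. t * m = m * t \<Longrightarrow> t * g = g * t"
    using selfadjoint_sqrt[OF m(1) m(3)] by metis
  have ym: "y * m = m * y" by (rule m(4)) (simp add: mult.assoc)
  have yg: "y * g = g * y" by (rule g(3)[OF ym])
  have mg: "m * g = g * m" by (rule g(3)) simp
  define f where "f = m - y"
  have f: "selfadjoint f" unfolding f_def by (rule selfadjoint_diff[OF m(1) y])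
  have fg: "f * g = g * f" by (simp add: f_def algebra_simps yg mg)
  have fy: "f * y = - (m * f)" by (simp add: f_def algebra_simps m(2) ym)
  have "f * y * f = - (m * f * f)" by (simp add: fy)
  also have "m * f * f = g * (f * g) * f" unfolding fg by (simp add: g(2)[symmetric] mult.assoc)
  also have "g * (f * g) * f = (g * f) * (g * f)" by (simp add: mult.assoc)
  finally have fyf: "f * y * f = - ((g * f) * (g * f))" .
  have gf: "selfadjoint (g * f)" by (rule selfadjoint_commuting_mult[OF g(1) f fg[symmetric]])
  have "f * z * f = of_real (r\<^sup>2) * (f * f) - f * (x * x) * f"
    by (simp add: z_def algebra_simps of_real_def)
  then have "Re (\<phi> (f * z * f)) = r\<^sup>2 * Re (\<phi> (f * f)) - Re (\<phi> (f * (x * x) * f))"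
    by (simp add: phi_diff of_real_def phi_scaleR del: of_real_power)
  then have "Re (\<phi> (f * z * f)) \<ge> 0"
    using moment_growth_vector_state[OF x f r growth] by simp
  moreover have "f * z * f = scaleR M (f * y * f)"
    using M by (simp add: y_def)
  ultimately have "Re (\<phi> (f * y * f)) \<ge> 0"
    using M by (simp add: phi_scaleR zero_le_mult_iff)
  then have "Re (\<phi> ((g * f) * (g * f))) \<le> 0" by (simp add: fyf phi_minus)
  then have "\<phi> ((g * f) * (g * f)) = 0"
    using phi_square[OF gf] by (auto simp: complex_nonneg_Reals_iff complex_eq_iff)
  then have "g * f = 0" by (rule selfadjoint_eq_0[OF gf])
  then have mf: "m * f = 0" by (simp add: g(2)[symmetric] mult.assoc)
  then have "f * y = 0" using fy by simp
  moreover have "f * m = 0"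
    using mf ym by (simp add: f_def algebra_simps)
  ultimately have "f * f = 0" by (simp add: f_def right_diff_distrib)
  then have "f = 0" using norm_square_selfadjoint[OF f] by simp
  then have "g * g = y" by (simp add: f_def g(2))
  define b where "b = scaleR (sqrt M) g"
  have "b * b = z" using M \<open>g * g = y\<close> by (simp add: b_def y_def)
  show ?thesis
  proof (rule norm_le_of_sum_squares[OF x])
    show "selfadjoint b" unfolding b_def by (rule selfadjoint_scaleR[OF g(1)])
    show "x * x + b * b = of_real (r\<^sup>2)" by (simp add: \<open>b * b = z\<close> z_def)
    have "x * z = z * x" by (simp add: z_def algebra_simps of_real_def)
    then have "x * y = y * x" by (simp add: y_def)
    then have "x * (y * y) = (y * y) * x" by (metis mult.assoc)
    then show "x * b = b * x" by (simp add: b_def g(3)[OF m(4)])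
  qed (use r in simp)
qed

end

section \<open>Derivations into the tensor square\<close>

text \<open>A pair \<open>(P, \<delta>)\<close> represents an element \<open>P\<close> together with its image
  \<open>D P = (\<Sum>i. a\<^sub>i \<otimes> b\<^sub>i)\<close> under a derivation into the tensor square, which is only recorded through
  the form \<open>\<delta> u v = (\<Sum>i. \<phi> (u * a\<^sub>i) * \<phi> (b\<^sub>i * v))\<close>.\<close>

type_synonym 'a tder = "'a \<times> ('a \<Rightarrow> 'a \<Rightarrow> complex)"

definition tone :: "'a::cstar_algebra tder" where
  "tone = (1, \<lambda>_ _. 0)"

definition tadd :: "'a::cstar_algebra tder \<Rightarrow> 'a tder \<Rightarrow> 'a tder" where
  "tadd p q = (fst p + fst q, \<lambda>u v. snd p u v + snd q u v)"

definition tscale :: "complex \<Rightarrow> 'a::cstar_algebra tder \<Rightarrow> 'a tder" where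
  "tscale c p = (scaleC c (fst p), \<lambda>u v. c * snd p u v)"

text \<open>The Leibniz rule \<open>D (P Q) = D P (1 \<otimes> Q) + (P \<otimes> 1) D Q\<close> seen
  through the form: Q is absorbed by the right argument, P by the left one.\<close>

definition tmult :: "'a::cstar_algebra tder \<Rightarrow> 'a tder \<Rightarrow> 'a tder" where
  "tmult p q = (fst p * fst q, \<lambda>u v. snd p u (fst q * v) + snd q (u * fst p) v)"

definition tprod :: "'a::cstar_algebra tder list \<Rightarrow> 'a tder" where
  "tprod ps = foldr tmult ps tone"

lemma tder_sel [simp]:
  "fst tone = 1" "snd tone u v = 0"
  "fst (tadd p q) = fst p + fst q" "snd (tadd p q) u v = snd p u v + snd q u v"
  "fst (tscale c p) = scaleC c (fst p)" "snd (tscale c p) u v = c * snd p u v"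
  "fst (tmult p q) = fst p * fst q"
  "snd (tmult p q) u v = snd p u (fst q * v) + snd q (u * fst p) v"
  by (simp_all add: tone_def tadd_def tscale_def tmult_def)

lemma tder_eqI:
  "fst p = fst q \<Longrightarrow> (\<And>u v. snd p u v = snd q u v) \<Longrightarrow> p = q"
  by (auto simp: prod_eq_iff)

lemma tmult_assoc: "tmult (tmult p q) r = tmult p (tmult q r)"
  by (rule tder_eqI) (simp_all add: mult.assoc)

lemma tmult_tone [simp]: "tmult tone p = p" "tmult p tone = p"
  by (rule tder_eqI; simp)+

lemma tprod_simps [simp]:
  "tprod [] = tone" "tprod (p # ps) = tmult p (tprod ps)"
  by (simp_all add: tprod_def)

lemma tprod_append: "tprod (ps @ qs) = tmult (tprod ps) (tprod qs)"
  by (induction ps) (simp_all add: tmult_assoc)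

lemma fst_tprod: "fst (tprod ps) = prod_list (map fst ps)"
  by (induction ps) simp_all

definition bilinear_form :: "('a::cstar_algebra \<Rightarrow> 'a \<Rightarrow> complex) \<Rightarrow> bool" where
  "bilinear_form \<delta> \<longleftrightarrow>
     (\<forall>u u' v. \<delta> (u + u') v = \<delta> u v + \<delta> u' v) \<and> (\<forall>u v v'. \<delta> u (v + v') = \<delta> u v + \<delta> u v') \<and>
     (\<forall>c u v. \<delta> (scaleC c u) v = c * \<delta> u v) \<and> (\<forall>c u v. \<delta> u (scaleC c v) = c * \<delta> u v)"

lemma bilinear_formD:
  assumes "bilinear_form \<delta>"
  shows "\<delta> (u + u') v = \<delta> u v + \<delta> u' v" "\<delta> u (v + v') = \<delta> u v + \<delta> u v'"
    "\<delta> (scaleC c u) v = c * \<delta> u v" "\<delta> u (scaleC c v) = c * \<delta> u v"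
  using assms by (auto simp: bilinear_form_def)

lemma bilinear_form_tmult:
  assumes "bilinear_form (snd p)" "bilinear_form (snd q)"
  shows "bilinear_form (snd (tmult p q))"
  unfolding bilinear_form_def
  by (simp add: bilinear_formD[OF assms(1)] bilinear_formD[OF assms(2)] distrib_left distrib_right
      mult_scaleC_left mult_scaleC_right)

lemma bilinear_form_tprod:
  "(\<And>p. p \<in> set ps \<Longrightarrow> bilinear_form (snd p)) \<Longrightarrow> bilinear_form (snd (tprod ps))"
  by (induction ps) (auto simp: bilinear_form_def[of "snd tone"] intro!: bilinear_form_tmult)

lemma tmult_tadd_left:
  assumes "bilinear_form (snd r)"
  shows "tmult (tadd p q) r = tadd (tmult p r) (tmult q r)"
  by (rule tder_eqI) (simp_all add: distrib_left distrib_right bilinear_formD[OF assms])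

lemma tmult_tadd_right:
  assumes "bilinear_form (snd r)"
  shows "tmult r (tadd p q) = tadd (tmult r p) (tmult r q)"
  by (rule tder_eqI) (simp_all add: distrib_left distrib_right bilinear_formD[OF assms])

lemma tmult_tscale_left:
  assumes "bilinear_form (snd r)"
  shows "tmult (tscale c p) r = tscale c (tmult p r)"
  by (rule tder_eqI) (simp_all add: mult_scaleC_left mult_scaleC_right bilinear_formD[OF assms] distrib_left)

lemma tmult_tscale_right:
  assumes "bilinear_form (snd r)"
  shows "tmult r (tscale c p) = tscale c (tmult r p)"
  by (rule tder_eqI) (simp_all add: mult_scaleC_left mult_scaleC_right bilinear_formD[OF assms] distrib_left)

text \<open>Only left multiplication by a generator is a constructor, so that inductions consume one
  letter at a time.\<close>

inductive_set talg :: "'a::cstar_algebra tder set \<Rightarrow> 'a tder set" for E where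
  one: "tone \<in> talg E"
| gen: "g \<in> E \<Longrightarrow> p \<in> talg E \<Longrightarrow> tmult g p \<in> talg E"
| add: "p \<in> talg E \<Longrightarrow> q \<in> talg E \<Longrightarrow> tadd p q \<in> talg E"
| scale: "p \<in> talg E \<Longrightarrow> tscale c p \<in> talg E"

lemma talg_bilinear:
  assumes "p \<in> talg E" "\<And>g. g \<in> E \<Longrightarrow> bilinear_form (snd g)"
  shows "bilinear_form (snd p)"
  using assms(1)
proof induction
  case (gen g p)
  then show ?case using assms(2) by (intro bilinear_form_tmult)
next
  case (add p q)
  then show ?case by (simp add: bilinear_form_def distrib_left)
next
  case (scale p c)
  then show ?case by (simp add: bilinear_form_def distrib_left)
qed (simp add: bilinear_form_def)

lemma talg_generator: "g \<in> E \<Longrightarrow> g \<in> talg E"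
  using talg.gen[OF _ talg.one, of g E] by simp

lemma talg_mult:
  assumes "p \<in> talg E" "q \<in> talg E" "\<And>g. g \<in> E \<Longrightarrow> bilinear_form (snd g)"
  shows "tmult p q \<in> talg E"
  using assms(1)
proof induction
  case one
  then show ?case using assms(2) by simp
next
  case (gen g p)
  then show ?case by (simp add: tmult_assoc talg.gen)
next
  case (add p p')
  then show ?case using talg_bilinear[OF assms(2,3)] by (simp add: tmult_tadd_left talg.add)
next
  case (scale p c)
  then show ?case using talg_bilinear[OF assms(2,3)] by (simp add: tmult_tscale_left talg.scale)
qed

lemma unital_subalgebra_fst_talg:
  assumes "\<And>g. g \<in> E \<Longrightarrow> bilinear_form (snd g)"
  shows "unital_subalgebra (fst ` talg E)"
proof -
  have "1 \<in> fst ` talg E" using imageI[OF talg.one, of fst E] by simp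
  moreover have "x + y \<in> fst ` talg E \<and> x * y \<in> fst ` talg E"
    if x: "x \<in> fst ` talg E" and y: "y \<in> fst ` talg E" for x y
  proof -
    from x y obtain p q where "p \<in> talg E" "q \<in> talg E" and xy: "x = fst p" "y = fst q" by auto
    then have "tadd p q \<in> talg E" "tmult p q \<in> talg E"
      by (auto intro: talg.add talg_mult assms)
    from this[THEN imageI, of fst] show ?thesis by (simp add: xy)
  qed
  moreover have "scaleC c x \<in> fst ` talg E" if x: "x \<in> fst ` talg E" for c x
  proof -
    from x obtain p where "p \<in> talg E" and xp: "x = fst p" by auto
    then have "tscale c p \<in> talg E" by (intro talg.scale)
    from imageI[OF this, of fst] show ?thesis by (simp add: xp)
  qed
  ultimately show ?thesis by (simp add: unital_subalgebra_def)
qed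

lemma unital_subalgebra_hull: "unital_subalgebra (unital_subalgebra hull S)"
  unfolding hull_def unital_subalgebra_def by blast

text \<open>Freeness speaks of elements of the hull, the derivation of pairs; this lifts the former
  to the latter.\<close>

lemma hull_subset_fst_talg:
  assumes "\<And>g. g \<in> E \<Longrightarrow> bilinear_form (snd g)"
  shows "unital_subalgebra hull (fst ` E) \<subseteq> fst ` talg E"
  by (rule hull_minimal)
    (auto intro: unital_subalgebra_fst_talg assms imageI talg_generator)

lemma fst_talg_in_hull:
  assumes "p \<in> talg E"
  shows "fst p \<in> unital_subalgebra hull (fst ` E)"
proof -
  define H where "H = unital_subalgebra hull (fst ` E)"
  have sub: "unital_subalgebra H" unfolding H_def by (rule unital_subalgebra_hull)
  have gen: "fst g \<in> H" if "g \<in> E" for g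
    using that hull_subset[of "fst ` E" unital_subalgebra] by (auto simp: H_def)
  have "fst p \<in> H"
    using assms by induction (use sub gen in \<open>simp_all add: unital_subalgebra_def\<close>)
  then show ?thesis by (simp add: H_def)
qed

text \<open>Blocks of a word are pairs of a subalgebra index and an element; merging neighbours and
  centring reduces a multilinear statement about all words to alternating centred ones.\<close>

lemma not_distinct_adjE:
  assumes "\<not> distinct_adj (map fst bs)"
  obtains xs i p q ys where "bs = xs @ (i, p) # (i, q) # ys"
  using assms
proof (induction bs arbitrary: thesis)
  case (Cons b bs)
  show ?case
  proof (cases bs)
    case Nil
    with Cons.prems show ?thesis by simp
  next
    case (Cons c cs)
    show ?thesis
    proof (cases "fst b = fst c")
      case True
      with Cons Cons.prems(1)[of "[]" "fst b" "snd b" "snd c" cs] show ?thesis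
        by (metis append_Nil prod.collapse)
    next
      case False
      with Cons Cons.prems(2) have "\<not> distinct_adj (map fst bs)" by simp
      then show ?thesis using Cons.IH Cons.prems(1) by (metis append_Cons)
    qed
  qed
qed simp

section \<open>Reduction to alternating centred words, and the Schwinger-Dyson equation\<close>

context cstar_state
begin

definition centred :: "('i \<times> 'a tder) \<Rightarrow> bool" where
  "centred b \<longleftrightarrow> \<phi> (fst (snd b)) = 0"

lemma block_reduction:
  assumes "\<And>b. b \<in> set bs \<Longrightarrow> snd b \<in> T (fst b)"
    and alternating: "\<And>bs. (\<And>b. b \<in> set bs \<Longrightarrow> snd b \<in> T (fst b)) \<Longrightarrow> distinct_adj (map fst bs) \<Longrightarrow>
      (\<And>b. b \<in> set bs \<Longrightarrow> centred b) \<Longrightarrow> Q (tprod (map snd bs))"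
    and T: "\<And>i p q. p \<in> T i \<Longrightarrow> q \<in> T i \<Longrightarrow> tmult p q \<in> T i"
      "\<And>i p c. p \<in> T i \<Longrightarrow> tadd p (tscale c tone) \<in> T i"
      "\<And>i p. p \<in> T i \<Longrightarrow> bilinear_form (snd p)"
    and Q: "\<And>p q. Q p \<Longrightarrow> Q q \<Longrightarrow> Q (tadd p q)" "\<And>c p. Q p \<Longrightarrow> Q (tscale c p)"
  shows "Q (tprod (map snd bs))"
  using assms(1)
\<comment> \<open>Merging two neighbours removes a block but may create a noncentred one, hence the
  weight 2. Centring lowers only the second summand.\<close>
proof (induction "2 * length bs + length (filter (\<lambda>b. \<not> centred b) bs)" arbitrary: bs rule: less_induct)
  case less
  show ?case
  proof (cases "distinct_adj (map fst bs)")
    case False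
    then obtain xs i p q ys where bs: "bs = xs @ (i, p) # (i, q) # ys"
      by (rule not_distinct_adjE)
    have "p \<in> T i" "q \<in> T i"
      using less.prems[of "(i, p)"] less.prems[of "(i, q)"] by (simp_all add: bs)
    then have "tmult p q \<in> T i" by (rule T(1))
    then have "snd b \<in> T (fst b)" if "b \<in> set (xs @ (i, tmult p q) # ys)" for b
      using that less.prems[of b] by (auto simp: bs)
    then have "Q (tprod (map snd (xs @ (i, tmult p q) # ys)))"
      by (rule less.hyps[rotated]) (auto simp: bs)
    then show ?thesis by (simp add: bs tprod_append tmult_assoc)
  next
    case adj: True
    show ?thesis
    proof (cases "\<forall>b\<in>set bs. centred b")
      case True
      then show ?thesis using adj less.prems by (intro alternating) auto
    next
      case False
      then obtain b where "b \<in> set bs" and nc: "\<not> centred b" by auto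
      then obtain xs ys where "bs = xs @ b # ys" by (auto simp: in_set_conv_decomp)
      then obtain i p where bs: "bs = xs @ (i, p) # ys" and b: "b = (i, p)" by (cases b) auto
      define c where "c = \<phi> (fst p)"
      define p' where "p' = tadd p (tscale (- c) tone)"
      have p: "p \<in> T i" using less.prems[of "(i, p)"] by (simp add: bs)
      then have p': "p' \<in> T i" unfolding p'_def by (rule T(2))
      have ctr: "centred (i, p')"
        by (simp add: centred_def p'_def c_def phi_add phi_scaleC phi_one)
      have 1: "Q (tprod (map snd (xs @ (i, p') # ys)))"
      proof (rule less.hyps[rotated])
        show "snd b \<in> T (fst b)" if "b \<in> set (xs @ (i, p') # ys)" for b
          using that less.prems[of b] p' by (auto simp: bs)
      qed (use nc ctr in \<open>simp add: bs b\<close>)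
      have 2: "Q (tprod (map snd (xs @ ys)))"
        by (rule less.hyps[rotated]) (use less.prems in \<open>auto simp: bs\<close>)
      have "p = tadd p' (tscale c tone)"
        by (rule tder_eqI) (simp_all add: p'_def scaleC_add_left[symmetric] add.assoc)
      then have "tprod (map snd bs)
        = tmult (tprod (map snd xs)) (tmult (tadd p' (tscale c tone)) (tprod (map snd ys)))"
        by (simp add: bs tprod_append)
      also have "\<dots> = tadd (tprod (map snd (xs @ (i, p') # ys))) (tscale c (tprod (map snd (xs @ ys))))"
      proof -
        have "snd ` set bs \<subseteq> {q. bilinear_form (snd q)}"
          using T(3)[OF less.prems] by blast
        then have "bilinear_form (snd (tprod (map snd xs)))" "bilinear_form (snd (tprod (map snd ys)))"
          by (intro bilinear_form_tprod; force simp: bs)+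
        then show ?thesis
          by (simp add: tmult_tadd_left tmult_tadd_right tmult_tscale_left tmult_tscale_right
              tprod_append)
      qed
      finally show ?thesis using 1 2 Q by simp
    qed
  qed
qed

text \<open>The form of the tensor \<open>1 \<otimes> x\<close>.\<close>

definition split_at :: "'a \<Rightarrow> 'a \<Rightarrow> 'a \<Rightarrow> complex" where
  "split_at x u v = \<phi> u * \<phi> (x * v)"

lemma bilinear_form_split_at: "bilinear_form (split_at x)"
  by (simp add: bilinear_form_def split_at_def phi_add phi_scaleC distrib_left distrib_right
      mult_scaleC_right)

lemma bilinear_form_zero: "bilinear_form (\<lambda>_ _. 0)"
  by (simp add: bilinear_form_def)

text \<open>The derivation maps the letters with index in \<open>J\<close> to \<open>1 \<otimes> g i\<close> and kills the others.\<close>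

definition letter :: "('i \<Rightarrow> 'a) \<Rightarrow> 'i set \<Rightarrow> 'i \<Rightarrow> 'a tder" where
  "letter g J i = (g i, if i \<in> J then split_at (g i) else (\<lambda>_ _. 0))"

lemma fst_letter [simp]: "fst (letter g J i) = g i"
  by (simp add: letter_def)

lemma snd_letter: "snd (letter g J i) u v = (if i \<in> J then \<phi> u * \<phi> (g i * v) else 0)"
  by (simp add: letter_def split_at_def)

lemma bilinear_letter: "bilinear_form (snd (letter g J i))"
  by (simp add: letter_def bilinear_form_split_at bilinear_form_zero)

text \<open>The Schwinger-Dyson equation for a Marchenko-Pastur element \<open>x\<close> with free cumulants
  \<open>\<beta> * \<alpha> ^ (n - 1)\<close>.\<close>

definition schwinger_dyson :: "'a \<Rightarrow> complex \<Rightarrow> complex \<Rightarrow> 'a tder \<Rightarrow> bool" where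
  "schwinger_dyson x \<beta> \<alpha> p \<longleftrightarrow> \<phi> (x * fst p) = \<beta> * \<phi> (fst p) + \<alpha> * snd p 1 1"

lemma schwinger_dyson_tadd:
  "schwinger_dyson x \<beta> \<alpha> p \<Longrightarrow> schwinger_dyson x \<beta> \<alpha> q \<Longrightarrow> schwinger_dyson x \<beta> \<alpha> (tadd p q)"
  by (simp add: schwinger_dyson_def distrib_left phi_add)

lemma schwinger_dyson_tscale:
  "schwinger_dyson x \<beta> \<alpha> p \<Longrightarrow> schwinger_dyson x \<beta> \<alpha> (tscale c p)"
  by (simp add: schwinger_dyson_def mult_scaleC_right phi_scaleC algebra_simps)

text \<open>The equation is linear in p, so words suffice. The induction carries an arbitrary word
  on the left, into which the generators peeled off from p are moved.\<close>

lemma schwinger_dyson_talg: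
  assumes p: "p \<in> talg E" and E: "\<And>g. g \<in> E \<Longrightarrow> bilinear_form (snd g)"
    and words: "\<And>ws. set ws \<subseteq> E \<Longrightarrow> schwinger_dyson x \<beta> \<alpha> (tprod ws)"
  shows "schwinger_dyson x \<beta> \<alpha> p"
proof -
  have "\<forall>ws. set ws \<subseteq> E \<longrightarrow> schwinger_dyson x \<beta> \<alpha> (tmult (tprod ws) p)"
    using p
  proof induction
    case one
    then show ?case using words by simp
  next
    case (gen g p)
    show ?case
    proof (intro allI impI)
      fix ws assume "set ws \<subseteq> E"
      then have "schwinger_dyson x \<beta> \<alpha> (tmult (tprod (ws @ [g])) p)"
        using gen.IH gen.hyps(1) by simp
      then show "schwinger_dyson x \<beta> \<alpha> (tmult (tprod ws) (tmult g p))"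
        by (simp add: tprod_append tmult_assoc)
    qed
  next
    case (add p q)
    have "bilinear_form (snd (tprod ws))" if "set ws \<subseteq> E" for ws
      using that by (intro bilinear_form_tprod E) auto
    then show ?case using add.IH by (simp add: tmult_tadd_right schwinger_dyson_tadd)
  next
    case (scale p c)
    have "bilinear_form (snd (tprod ws))" if "set ws \<subseteq> E" for ws
      using that by (intro bilinear_form_tprod E) auto
    then show ?case using scale.IH by (simp add: tmult_tscale_right schwinger_dyson_tscale)
  qed
  from this[rule_format, of "[]"] show ?thesis by simp
qed

text \<open>\<open>D (x ^ n)\<close> is the sum of \<open>x ^ k \<otimes> x ^ (n - k)\<close> over k
  < n: the letter at which the word is cut stays in the right leg, which is therefore never
  1.\<close>

lemma tprod_replicate:
  "fst (tprod (replicate n (letter g J i))) = g i ^ n"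
  "i \<in> J \<Longrightarrow> snd (tprod (replicate n (letter g J i))) u v
     = (\<Sum>k<n. \<phi> (u * g i ^ k) * \<phi> (g i ^ (n - k) * v))"
proof -
  show *: "fst (tprod (replicate n (letter g J i))) = g i ^ n" for n
    by (simp add: fst_tprod)
  show "snd (tprod (replicate n (letter g J i))) u v
     = (\<Sum>k<n. \<phi> (u * g i ^ k) * \<phi> (g i ^ (n - k) * v))" if "i \<in> J"
  proof (induction n arbitrary: u)
    case (Suc n)
    then show ?case
      using that by (subst sum.lessThan_Suc_shift) (simp add: snd_letter * mult.assoc)
  qed simp
qed

lemma snd_tprod_zero:
  assumes "\<And>xs p ys. ps = xs @ p # ys \<Longrightarrow> snd p (u * fst (tprod xs)) (fst (tprod ys) * v) = 0"
  shows "snd (tprod ps) u v = 0"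
  using assms
proof (induction ps arbitrary: u)
  case (Cons p ps)
  have "snd (tprod ps) (u * fst p) v = 0"
  proof (rule Cons.IH)
    fix xs q ys assume "ps = xs @ q # ys"
    then show "snd q (u * fst p * fst (tprod xs)) (fst (tprod ys) * v) = 0"
      using Cons.prems[of "p # xs" q ys] by (simp add: mult.assoc)
  qed
  then show ?case using Cons.prems[of "[]" p ps] by simp
qed simp

lemma snd_talg_zero:
  assumes "p \<in> talg {letter g J i}" "i \<notin> J"
  shows "snd p u v = 0"
  using assms by (induction arbitrary: u v) (auto simp: snd_letter)

text \<open>Both legs of \<open>D p\<close> are polynomials in \<open>g i\<close>, so a functional
  that kills those through one slot kills the form. The companion lemma below treats the other
  slot.\<close>

lemma snd_talg_zero_left:
  assumes "p \<in> talg {letter g J i}" "\<And>a. a \<in> unital_subalgebra hull {g i} \<Longrightarrow> \<phi> (u * a) = 0"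
  shows "snd p u v = 0"
  using assms
proof (induction arbitrary: u v)
  case (gen h p)
  have "1 \<in> unital_subalgebra hull {g i}" "g i \<in> unital_subalgebra hull {g i}"
    and mult: "\<And>a. a \<in> unital_subalgebra hull {g i} \<Longrightarrow> g i * a \<in> unital_subalgebra hull {g i}"
    using unital_subalgebra_hull[of "{g i}"] hull_subset[of "{g i}" unital_subalgebra]
    by (auto simp: unital_subalgebra_def)
  with gen.prems[of 1] have "\<phi> u = 0" by simp
  moreover have "snd p (u * g i) v = 0"
    using gen.prems mult by (intro gen.IH) (simp add: mult.assoc)
  ultimately show ?case using gen.hyps by (simp add: snd_letter)
qed auto

lemma snd_talg_zero_right:
  assumes "p \<in> talg {letter g J i}" "\<And>a. a \<in> unital_subalgebra hull {g i} \<Longrightarrow> \<phi> (a * v) = 0"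
  shows "snd p u v = 0"
  using assms
proof (induction arbitrary: u v)
  case (gen h p)
  have "g i * fst p \<in> unital_subalgebra hull {g i}"
    using unital_subalgebra_hull[of "{g i}"] hull_subset[of "{g i}" unital_subalgebra]
      fst_talg_in_hull[OF gen.hyps(2)]
    by (auto simp: unital_subalgebra_def)
  from gen.prems[OF this] have "\<phi> (g i * fst p * v) = 0" .
  then show ?case using gen by (simp add: snd_letter mult.assoc)
qed auto

end

section \<open>Freeness and the Schwinger-Dyson equation\<close>

lemma talg_mono:
  assumes "p \<in> talg E" "E \<subseteq> F"
  shows "p \<in> talg F"
  using assms(1) by induction (use assms(2) in \<open>auto intro: talg.intros\<close>)

lemma talg_tprod:
  assumes "\<And>p. p \<in> set ps \<Longrightarrow> p \<in> talg E" "\<And>g. g \<in> E \<Longrightarrow> bilinear_form (snd g)"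
  shows "tprod ps \<in> talg E"
  using assms(1) by (induction ps) (auto intro: talg.one talg_mult assms(2))

context cstar_state
begin

definition alternating :: "('i \<Rightarrow> 'a) \<Rightarrow> 'i set \<Rightarrow> ('i \<times> 'a tder) list \<Rightarrow> bool" where
  "alternating g J bs \<longleftrightarrow>
     (\<forall>b\<in>set bs. snd b \<in> talg {letter g J (fst b)} \<and> centred b) \<and> distinct_adj (map fst bs)"

abbreviation block_prod :: "('i \<times> 'a tder) list \<Rightarrow> 'a" where
  "block_prod bs \<equiv> fst (tprod (map snd bs))"

lemma block_prod_append: "block_prod (xs @ ys) = block_prod xs * block_prod ys"
  by (simp add: tprod_append)

lemma hull_letterE:
  assumes "a \<in> unital_subalgebra hull {g i}"
  obtains p where "p \<in> talg {letter g J i}" "fst p = a"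
  using assms hull_subset_fst_talg[of "{letter g J i}"] bilinear_letter by force

lemma fst_talg_letter: "p \<in> talg {letter g J i} \<Longrightarrow> fst p \<in> unital_subalgebra hull {g i}"
  using fst_talg_in_hull[of p "{letter g J i}"] by simp

text \<open>Each hull element gets a lift by choice, and the lifts keep the first components, which
  are what freeness sees.\<close>

lemma free_family_iff_alternating:
  "free_family \<phi> UNIV (\<lambda>i. unital_subalgebra hull {g i}) \<longleftrightarrow>
    (\<forall>bs. alternating g J bs \<and> bs \<noteq> [] \<longrightarrow> \<phi> (block_prod bs) = 0)"
proof (intro iffI allI impI)
  fix bs
  assume free: "free_family \<phi> UNIV (\<lambda>i. unital_subalgebra hull {g i})"
    and bs: "alternating g J bs \<and> bs \<noteq> []"
  define w where "w = map (\<lambda>b. (fst b, fst (snd b))) bs"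
  have w: "map fst w = map fst bs" "map snd w = map fst (map snd bs)" "w \<noteq> []"
    using bs by (simp_all add: w_def)
  have "snd c \<in> unital_subalgebra hull {g (fst c)} \<and> \<phi> (snd c) = 0" if "c \<in> set w" for c
  proof -
    from that obtain b where "b \<in> set bs" and c: "c = (fst b, fst (snd b))" by (auto simp only: w_def set_map)
    with bs have "snd b \<in> talg {letter g J (fst b)}" "centred b" by (simp_all add: alternating_def)
    with fst_talg_letter[of "snd b" g J "fst b"] show ?thesis by (simp add: c centred_def)
  qed
  then have "\<forall>(i, a)\<in>set w. i \<in> UNIV \<and> a \<in> unital_subalgebra hull {g i} \<and> \<phi> a = 0"
    by (simp add: split_beta)
  moreover have "distinct_adj (map fst w)" using bs by (simp only: w alternating_def)
  ultimately have "\<phi> (prod_list (map snd w)) = 0"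
    by (intro free[unfolded free_family_def, THEN spec, THEN mp] conjI w(3))
  then show "\<phi> (block_prod bs) = 0" unfolding fst_tprod w(2) .
next
  assume *: "\<forall>bs. alternating g J bs \<and> bs \<noteq> [] \<longrightarrow> \<phi> (block_prod bs) = 0"
  show "free_family \<phi> UNIV (\<lambda>i. unital_subalgebra hull {g i})"
    unfolding free_family_def
  proof (intro allI impI)
    fix w :: "('b \<times> 'a) list"
    assume w: "w \<noteq> [] \<and> (\<forall>(i, a)\<in>set w. i \<in> UNIV \<and> a \<in> unital_subalgebra hull {g i} \<and> \<phi> a = 0) \<and>
      distinct_adj (map fst w)"
    define P where "P b = (SOME p. p \<in> talg {letter g J (fst b)} \<and> fst p = snd b)" for b
    have P: "P b \<in> talg {letter g J (fst b)} \<and> fst (P b) = snd b" if "b \<in> set w" for b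
    proof -
      have "snd b \<in> unital_subalgebra hull {g (fst b)}" using w that by (auto simp: split_beta)
      then have "\<exists>p. p \<in> talg {letter g J (fst b)} \<and> fst p = snd b"
        by (rule hull_letterE[where g = g and i = "fst b" and J = J]) blast
      then show ?thesis unfolding P_def by (rule someI_ex)
    qed
    define bs where "bs = map (\<lambda>b. (fst b, P b)) w"
    have "snd b \<in> talg {letter g J (fst b)} \<and> centred b" if "b \<in> set bs" for b
    proof -
      from that obtain c where c: "c \<in> set w" "b = (fst c, P c)" by (auto simp only: bs_def set_map)
      moreover have "\<phi> (snd c) = 0" using c(1) w by (simp add: split_beta)
      ultimately show ?thesis using P[OF c(1)] by (simp add: centred_def)
    qed
    moreover have "map fst bs = map fst w" by (simp add: bs_def)
    ultimately have "alternating g J bs" using w by (simp add: alternating_def)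
    moreover have "bs \<noteq> []" using w by (simp add: bs_def)
    ultimately have "\<phi> (block_prod bs) = 0" using * by simp
    moreover have "map fst (map snd bs) = map snd w" by (simp add: bs_def P)
    ultimately show "\<phi> (prod_list (map snd w)) = 0" by (simp only: fst_tprod)
  qed
qed

lemma centre_talg:
  assumes "a \<in> unital_subalgebra hull {g i}"
  obtains p where "p \<in> talg {letter g J i}" "\<phi> (fst p) = 0" "a = fst p + scaleC (\<phi> a) 1"
proof -
  obtain q where q: "q \<in> talg {letter g J i}" "fst q = a"
    using hull_letterE[where g = g and i = i and J = J, OF assms] .
  show ?thesis
  proof (rule that[of "tadd q (tscale (- \<phi> a) tone)"])
    show "tadd q (tscale (- \<phi> a) tone) \<in> talg {letter g J i}"
      by (intro talg.add talg.scale talg.one q)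
  qed (simp_all add: q phi_add phi_scaleC phi_one add.assoc scaleC_add_left[symmetric])
qed

text \<open>Centring a leaves a multiple of \<open>block_prod bs\<close> and an alternating word
  with one more block. The length bound in \<open>zero\<close> makes the lemma usable inside an
  induction on word length.\<close>

lemma alternating_left_zero:
  assumes zero: "\<And>cs. alternating g J cs \<Longrightarrow> cs \<noteq> [] \<Longrightarrow> length cs \<le> Suc (length bs) \<Longrightarrow>
      \<phi> (block_prod cs) = 0"
    and bs: "alternating g J bs" "bs \<noteq> []" "fst (hd bs) \<noteq> i"
    and a: "a \<in> unital_subalgebra hull {g i}"
  shows "\<phi> (a * block_prod bs) = 0"
proof -
  obtain p where p: "p \<in> talg {letter g J i}" "\<phi> (fst p) = 0" "a = fst p + scaleC (\<phi> a) 1"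
    using centre_talg[where g = g and i = i and J = J, OF a] .
  have "alternating g J ((i, p) # bs)"
    using bs p by (cases bs) (auto simp: alternating_def centred_def)
  then have "\<phi> (fst p * block_prod bs) = 0" using zero[of "(i, p) # bs"] by simp
  moreover have "a * block_prod bs = fst p * block_prod bs + scaleC (\<phi> a) (block_prod bs)"
    by (subst p(3)) (simp add: distrib_right mult_scaleC_left)
  ultimately show ?thesis using zero[OF bs(1,2)] by (simp add: phi_add phi_scaleC)
qed

lemma alternating_right_zero:
  assumes zero: "\<And>cs. alternating g J cs \<Longrightarrow> cs \<noteq> [] \<Longrightarrow> length cs \<le> Suc (length bs) \<Longrightarrow>
      \<phi> (block_prod cs) = 0"
    and bs: "alternating g J bs" "bs \<noteq> []" "fst (last bs) \<noteq> i"
    and a: "a \<in> unital_subalgebra hull {g i}"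
  shows "\<phi> (block_prod bs * a) = 0"
proof -
  obtain p where p: "p \<in> talg {letter g J i}" "\<phi> (fst p) = 0" "a = fst p + scaleC (\<phi> a) 1"
    using centre_talg[where g = g and i = i and J = J, OF a] .
  have "alternating g J (bs @ [(i, p)])"
    using bs p by (auto simp: alternating_def centred_def distinct_adj_append_iff last_map)
  then have "\<phi> (block_prod bs * fst p) = 0"
    using zero[of "bs @ [(i, p)]"] by (simp add: tprod_append)
  moreover have "block_prod bs * a = block_prod bs * fst p + scaleC (\<phi> a) (block_prod bs)"
    by (subst p(3)) (simp add: distrib_left mult_scaleC_right)
  ultimately show ?thesis using zero[OF bs(1,2)] by (simp add: phi_add phi_scaleC)
qed

lemma alternating_append:
  "alternating g J (xs @ ys) \<longleftrightarrow> alternating g J xs \<and> alternating g J ys \<and>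
    (xs = [] \<or> ys = [] \<or> fst (last xs) \<noteq> fst (hd ys))"
  by (auto simp: alternating_def distinct_adj_append_iff last_map hd_map)

lemma alternating_Cons:
  "alternating g J (b # bs) \<longleftrightarrow> snd b \<in> talg {letter g J (fst b)} \<and> centred b \<and>
    alternating g J bs \<and> (bs = [] \<or> fst b \<noteq> fst (hd bs))"
  by (cases bs) (auto simp: alternating_def)

lemma schwinger_dyson_single:
  assumes moments: "\<And>n. \<phi> (g i ^ Suc n)
      = \<beta> * \<phi> (g i ^ n) + \<alpha> * (\<Sum>k<n. \<phi> (g i ^ k) * \<phi> (g i ^ (n - k)))"
    and "i \<in> J" "p \<in> talg {letter g J i}"
  shows "schwinger_dyson (g i) \<beta> \<alpha> p"
  using assms(3)
proof (rule schwinger_dyson_talg)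
  fix ws assume "set ws \<subseteq> {letter g J i}"
  then have ws: "ws = replicate (length ws) (letter g J i)"
    by (intro replicate_eqI) auto
  show "schwinger_dyson (g i) \<beta> \<alpha> (tprod ws)"
    by (subst ws) (use moments[of "length ws"] assms(2) in \<open>simp add: schwinger_dyson_def tprod_replicate\<close>)
qed (auto simp: bilinear_letter)

text \<open>Both sides are linear in the word, so alternating centred words suffice. For a word
  inside the algebra of \<open>g j\<close> the claim is the moment recursion; for every other one
  freeness makes all three terms vanish.\<close>

lemma free_imp_schwinger_dyson:
  assumes free: "free_family \<phi> UNIV (\<lambda>i. unital_subalgebra hull {g i})"
    and moments: "\<And>n. \<phi> (g j ^ Suc n)
      = \<beta> * \<phi> (g j ^ n) + \<alpha> * (\<Sum>k<n. \<phi> (g j ^ k) * \<phi> (g j ^ (n - k)))"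
  shows "schwinger_dyson (g j) \<beta> \<alpha> (tprod (map (letter g {j}) ws))"
proof -
  have zero: "\<phi> (block_prod cs) = 0" if "alternating g {j} cs" "cs \<noteq> []" for cs
    using free that free_family_iff_alternating by blast
  define bs where "bs = map (\<lambda>i. (i, letter g {j} i)) ws"
  have "schwinger_dyson (g j) \<beta> \<alpha> (tprod (map snd bs))"
  proof (rule block_reduction[where T = "\<lambda>i. talg {letter g {j} i}"])
    show "snd b \<in> talg {letter g {j} (fst b)}" if "b \<in> set bs" for b
      using that by (auto simp: bs_def intro: talg_generator)
  next
    fix bs :: "('b \<times> 'a tder) list"
    assume "\<And>b. b \<in> set bs \<Longrightarrow> snd b \<in> talg {letter g {j} (fst b)}"
      "distinct_adj (map fst bs)" "\<And>b. b \<in> set bs \<Longrightarrow> centred b"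
    then have bs: "alternating g {j} bs" by (simp add: alternating_def)
    have single: "schwinger_dyson (g j) \<beta> \<alpha> p" if "p \<in> talg {letter g {j} j}" for p
      by (rule schwinger_dyson_single[OF moments _ that]) simp
    show "schwinger_dyson (g j) \<beta> \<alpha> (tprod (map snd bs))"
    proof (cases "bs = [] \<or> (\<exists>p. bs = [(j, p)])")
      case True
      then have "tprod (map snd bs) \<in> talg {letter g {j} j}"
        using bs by (auto simp: alternating_Cons intro: talg.one)
      then show ?thesis by (rule single)
    next
      case False
      then have "bs \<noteq> []" by simp
      have hull: "g j \<in> unital_subalgebra hull {g j}"
        using hull_subset[of "{g j}" unital_subalgebra] by auto
      have "\<phi> (g j * block_prod bs) = 0"
      proof (cases "fst (hd bs) = j")
        case True
        with \<open>bs \<noteq> []\<close> obtain p ys where ys: "bs = (j, p) # ys" by (cases bs) auto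
        with False have "ys \<noteq> []" by auto
        have "p \<in> talg {letter g {j} j}" using bs by (simp add: ys alternating_Cons)
        then have "fst p \<in> unital_subalgebra hull {g j}" by (rule fst_talg_letter)
        with hull have "g j * fst p \<in> unital_subalgebra hull {g j}"
          using unital_subalgebra_hull[of "{g j}"] by (auto simp: unital_subalgebra_def)
        then have "\<phi> (g j * fst p * block_prod ys) = 0"
          using bs \<open>ys \<noteq> []\<close> by (intro alternating_left_zero[OF zero]) (auto simp: ys alternating_Cons)
        then show ?thesis by (simp add: ys mult.assoc)
      next
        case False
        then show ?thesis
          using bs \<open>bs \<noteq> []\<close> hull by (intro alternating_left_zero[OF zero])
      qed
      moreover have "\<phi> (block_prod bs) = 0" using zero bs \<open>bs \<noteq> []\<close> .
      moreover have "snd (tprod (map snd bs)) 1 1 = 0"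
      proof (rule snd_tprod_zero)
        fix xs p ys assume "map snd bs = xs @ p # ys"
        then obtain l i r where l: "bs = l @ (i, p) # r" "xs = map snd l" "ys = map snd r"
          by (auto simp: map_eq_append_conv map_eq_Cons_conv)
        have p: "p \<in> talg {letter g {j} i}" and alt: "alternating g {j} l" "alternating g {j} r"
          using bs by (auto simp: l alternating_append alternating_Cons)
        show "snd p (1 * fst (tprod xs)) (fst (tprod ys) * 1) = 0"
        proof (cases "i = j")
          case i: True
          \<comment> \<open>The cut falls inside a \<open>j\<close>-block. The word is not that
            block alone, so on one side of the cut there is a nonempty alternating word whose block
            next to the cut lies outside \<open>j\<close>; it vanishes against the whole algebra of
            \<open>g j\<close>.\<close>
          show ?thesis
          proof (cases "l = []")
            case True
            then have "r \<noteq> []" "fst (hd r) \<noteq> j"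
              using False bs i by (auto simp: l alternating_Cons)
            then have "\<phi> (a * block_prod r) = 0" if "a \<in> unital_subalgebra hull {g j}" for a
              using that alt by (intro alternating_left_zero[OF zero])
            then show ?thesis using p i by (intro snd_talg_zero_right) (auto simp: l)
          next
            case False
            then have "fst (last l) \<noteq> j"
              using bs i by (auto simp: l alternating_append)
            then have "\<phi> (block_prod l * a) = 0" if "a \<in> unital_subalgebra hull {g j}" for a
              using that alt False by (intro alternating_right_zero[OF zero])
            then show ?thesis using p i by (intro snd_talg_zero_left) (auto simp: l)
          qed
        qed (use snd_talg_zero[OF p] in simp)
      qed
      ultimately show ?thesis by (simp add: schwinger_dyson_def)
    qed
  next
    show "tmult p q \<in> talg {letter g {j} i}"
      if "p \<in> talg {letter g {j} i}" "q \<in> talg {letter g {j} i}" for i p q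
      using that by (rule talg_mult) (simp add: bilinear_letter)
    show "tadd p (tscale c tone) \<in> talg {letter g {j} i}" if "p \<in> talg {letter g {j} i}" for i p c
      by (rule talg.add[OF that talg.scale[OF talg.one]])
    show "bilinear_form (snd p)" if "p \<in> talg {letter g {j} i}" for i p
      using that by (rule talg_bilinear) (simp add: bilinear_letter)
  qed (rule schwinger_dyson_tadd schwinger_dyson_tscale; assumption)+
  moreover have "map snd bs = map (letter g {j}) ws" by (simp add: bs_def)
  ultimately show ?thesis by simp
qed

text \<open>The derivation acting on both letters is the sum of those acting on one letter each, and
  the two equations can be added because they share \<alpha>.\<close>

lemma schwinger_dyson_sum:
  fixes g :: "bool \<Rightarrow> 'a"
  assumes "schwinger_dyson (g True) \<beta> \<alpha> (tprod (map (letter g {True}) ws))"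
    and "schwinger_dyson (g False) \<gamma> \<alpha> (tprod (map (letter g {False}) ws))"
  shows "schwinger_dyson (g True + g False) (\<beta> + \<gamma>) \<alpha> (tprod (map (letter g UNIV) ws))"
proof -
  have fst: "fst (tprod (map (letter g J) ws)) = fst (tprod (map (letter g UNIV) ws))" for J ws
    by (simp add: fst_tprod o_def)
  have snd: "snd (tprod (map (letter g UNIV) ws)) u v
      = snd (tprod (map (letter g {True}) ws)) u v + snd (tprod (map (letter g {False}) ws)) u v"
    for u v
    by (induction ws arbitrary: u) (auto simp: snd_letter fst[of "{True}"] fst[of "{False}"])
  show ?thesis
    using assms
    by (simp add: schwinger_dyson_def snd fst[of "{True}"] fst[of "{False}"] distrib_right
        distrib_left phi_add algebra_simps)
qed

end

section \<open>From the Schwinger-Dyson equation back to freeness\<close>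

context tracial_state
begin

text \<open>Strong induction on the number of blocks. A word that begins with a
  \<open>j\<close>-block is handled by comparing two recursions; traciality rotates any longer word
  into such a one or into shorter ones.\<close>

lemma schwinger_dyson_imp_free:
  fixes g :: "bool \<Rightarrow> 'a"
  assumes words: "\<And>ws. schwinger_dyson (g j) \<beta> \<alpha> (tprod (map (letter g {j}) ws))"
  shows "free_family \<phi> UNIV (\<lambda>i. unital_subalgebra hull {g i})"
proof -
  define E where "E = range (letter g {j})"
  have E: "bilinear_form (snd h)" if "h \<in> E" for h
    using that by (auto simp: E_def bilinear_letter)
  have sd: "schwinger_dyson (g j) \<beta> \<alpha> p" if "p \<in> talg E" for p
  proof (rule schwinger_dyson_talg[OF that E])
    fix ws assume "set ws \<subseteq> E"
    then have "\<exists>vs. ws = map (letter g {j}) vs"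
      by (induction ws) (auto simp: E_def intro: exI[of _ "_ # _"])
    then show "schwinger_dyson (g j) \<beta> \<alpha> (tprod ws)" using words by auto
  qed
  have in_E: "p \<in> talg E" if "p \<in> talg {letter g {j} i}" for p i
    using that by (rule talg_mono) (auto simp: E_def)
  define pw where "pw n = tprod (replicate n (letter g {j} j))" for n
  have pw_E: "pw n \<in> talg E" for n
    unfolding pw_def by (rule talg_tprod[OF _ E]) (auto simp: E_def intro: talg_generator)
  have pw: "fst (pw n) = g j ^ n"
    "snd (pw n) u v = (\<Sum>k<n. \<phi> (u * g j ^ k) * \<phi> (g j ^ (n - k) * v))" for n u v
    by (simp_all add: pw_def tprod_replicate)
  have hull_mult: "a * b \<in> unital_subalgebra hull {g j}"
    if "a \<in> unital_subalgebra hull {g j}" "b \<in> unital_subalgebra hull {g j}" for a b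
    using that unital_subalgebra_hull[of "{g j}"] by (auto simp: unital_subalgebra_def)
  have pw_hull: "g j ^ n \<in> unital_subalgebra hull {g j}" for n
    using unital_subalgebra_hull[of "{g j}"] hull_subset[of "{g j}" unital_subalgebra]
    by (induction n) (auto simp: unital_subalgebra_def)

  \<comment> \<open>With q the first block and Q the product of the others, the aim is \<phi>(q Q) =
    \<phi>(q) \<phi>(Q), which is 0 since q is centred.\<close>
  have head: "\<phi> (block_prod bs) = 0"
    if IH: "\<And>cs. alternating g {j} cs \<Longrightarrow> cs \<noteq> [] \<Longrightarrow> length cs < length bs \<Longrightarrow>
        \<phi> (block_prod cs) = 0"
      and bs: "alternating g {j} bs" "bs \<noteq> []" "fst (hd bs) = j" for bs
  proof -
    from bs obtain q bs' where bs': "bs = (j, q) # bs'" by (cases bs) auto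
    have q: "q \<in> talg {letter g {j} j}" "\<phi> (fst q) = 0"
      and alt: "alternating g {j} bs'" "bs' = [] \<or> fst (hd bs') \<noteq> j"
      using bs by (auto simp: bs' alternating_Cons centred_def)
    define Q where "Q = tprod (map snd bs')"
    have Q: "Q \<in> talg E"
      unfolding Q_def
    proof (rule talg_tprod[OF _ E])
      fix p assume "p \<in> set (map snd bs')"
      then obtain c where "c \<in> set bs'" "p = snd c" unfolding set_map by blast
      with alt(1) show "p \<in> talg E" by (auto simp: alternating_def intro: in_E[of _ "fst c"])
    qed
    \<comment> \<open>By traciality the left leg s of a cut block moves to the front, giving
      \<open>s * a\<close> times the part l before the cut. That part starts outside
      \<open>j\<close> and is short enough for the induction hypothesis.\<close>
    have Q_zero: "snd Q a 1 = 0" if a: "a \<in> unital_subalgebra hull {g j}" for a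
      unfolding Q_def
    proof (rule snd_tprod_zero)
      fix xs p ys assume "map snd bs' = xs @ p # ys"
      then obtain l i r where l: "bs' = l @ (i, p) # r" "xs = map snd l" "ys = map snd r"
        by (auto simp: map_eq_append_conv map_eq_Cons_conv)
      have p: "p \<in> talg {letter g {j} i}" and l_alt: "alternating g {j} l"
        using alt by (auto simp: l alternating_append alternating_Cons)
      show "snd p (a * fst (tprod xs)) (fst (tprod ys) * 1) = 0"
      proof (cases "i = j")
        case i: True
        then have "l \<noteq> []" "fst (hd l) \<noteq> j" using alt(2) by (cases l; auto simp: l)+
        have "\<phi> (a * block_prod l * s) = 0" if "s \<in> unital_subalgebra hull {g j}" for s
        proof -
          have "\<phi> (s * a * block_prod l) = 0"
            using \<open>l \<noteq> []\<close> \<open>fst (hd l) \<noteq> j\<close> l_alt hull_mult[OF that a]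
            by (intro alternating_left_zero[where J = "{j}" and i = j] IH) (auto simp: l bs')
          then show ?thesis using phi_commute[of s "a * block_prod l"] by (simp add: mult.assoc)
        qed
        then show ?thesis using p i by (intro snd_talg_zero_left) (auto simp: l)
      qed (use snd_talg_zero[OF p] in simp)
    qed
    \<comment> \<open>\<open>Q_zero\<close> removes the contribution of \<open>D Q\<close>, so
      \<phi>(g^n Q) and \<phi>(g^n) \<phi>(Q) obey the same recursion in n.\<close>
    have power: "\<phi> (g j ^ n * fst Q) = \<phi> (g j ^ n) * \<phi> (fst Q)" for n
    proof (induction n rule: less_induct)
      case (less n)
      show ?case
      proof (cases n)
        case 0
        then show ?thesis by (simp add: phi_one)
      next
        case (Suc m)
        have "\<phi> (g j ^ n) = \<beta> * \<phi> (g j ^ m) + \<alpha> * (\<Sum>k<m. \<phi> (g j ^ k) * \<phi> (g j ^ (m - k)))"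
          using sd[OF pw_E[of m]] by (simp add: schwinger_dyson_def pw Suc)
        moreover have "\<phi> (g j ^ n * fst Q) = \<beta> * \<phi> (g j ^ m * fst Q)
            + \<alpha> * (\<Sum>k<m. \<phi> (g j ^ k) * \<phi> (g j ^ (m - k) * fst Q))"
          using sd[OF talg_mult[OF pw_E[of m] Q E]] Q_zero[OF pw_hull, of m]
          by (simp add: schwinger_dyson_def pw Suc mult.assoc)
        moreover have "\<phi> (g j ^ m * fst Q) = \<phi> (g j ^ m) * \<phi> (fst Q)"
          by (rule less) (simp add: Suc)
        moreover have "(\<Sum>k<m. \<phi> (g j ^ k) * \<phi> (g j ^ (m - k) * fst Q))
          = (\<Sum>k<m. \<phi> (g j ^ k) * \<phi> (g j ^ (m - k))) * \<phi> (fst Q)"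
          unfolding sum_distrib_right by (rule sum.cong) (auto simp: less Suc mult.assoc)
        ultimately show ?thesis by (simp add: algebra_simps)
      qed
    qed
    have "\<phi> (g j ^ n * (fst p * fst Q)) = \<phi> (g j ^ n * fst p) * \<phi> (fst Q)"
      if "p \<in> talg {letter g {j} j}" for p n
      using that
    proof (induction arbitrary: n)
      case one
      then show ?case by (simp add: power)
    next
      case (gen h p)
      then show ?case
        using gen.IH[of "Suc n"] by (simp add: mult.assoc power_Suc2 del: power_Suc)
    next
      case (add p q)
      then show ?case by (simp add: distrib_left distrib_right phi_add)
    next
      case (scale p c)
      then show ?case by (simp add: mult_scaleC_left mult_scaleC_right phi_scaleC)
    qed
    from this[OF q(1), of 0] show ?thesis using q(2) by (simp add: bs' Q_def)
  qed

  have "\<phi> (block_prod bs) = 0" if "alternating g {j} bs" "bs \<noteq> []" for bs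
    using that
  proof (induction "length bs" arbitrary: bs rule: less_induct)
    case less
    note IH = less.hyps and bs = less.prems
    show ?case
    proof (cases "fst (hd bs) = j")
      case True
      with bs show ?thesis by (intro head[of bs] IH)
    next
      case hd: False
      then obtain i p bs' where bs': "bs = (i, p) # bs'" "i \<noteq> j" using bs by (cases bs) auto
      have p: "p \<in> talg {letter g {j} i}" "\<phi> (fst p) = 0" "alternating g {j} bs'"
        "bs' = [] \<or> fst (hd bs') \<noteq> i"
        using bs by (auto simp: bs' alternating_Cons centred_def)
      show ?thesis
      proof (cases "bs' = []")
        case True
        then show ?thesis using p by (simp add: bs')
      next
        case ne: False
        then have hd': "fst (hd bs') = j" using p(4) bs'(2) by auto
        obtain m k q where m: "bs' = m @ [(k, q)]" using ne by (cases bs' rule: rev_cases) auto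
        show ?thesis
        \<comment> \<open>A last block in \<open>j\<close> is rotated to the front, where
          \<open>head\<close> applies. Otherwise it has the index of the first block, there being
          only two indices; rotating the first block to the end merges them, and centring leaves
          shorter words.\<close>
        proof (cases "k = j")
          case True
          have cyc: "\<phi> (block_prod bs) = \<phi> (block_prod ((k, q) # (i, p) # m))"
            using phi_commute[of "fst p * block_prod m" "fst q"]
            by (simp add: bs' m block_prod_append tprod_append mult.assoc)
          have "\<phi> (block_prod ((k, q) # (i, p) # m)) = 0"
          proof (rule head)
            show "alternating g {j} ((k, q) # (i, p) # m)"
              using p bs' True bs by (auto simp: m alternating_Cons alternating_append centred_def)
            show "\<phi> (block_prod cs) = 0"
              if "alternating g {j} cs" "cs \<noteq> []" "length cs < length ((k, q) # (i, p) # m)" for cs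
              using that by (intro IH) (simp_all add: bs' m)
          qed (simp_all add: True)
          then show ?thesis by (simp add: cyc)
        next
          case False
          then have "k = i" using bs'(2) by auto
          have "m \<noteq> []" using hd' False by (auto simp: m)
          have alt: "alternating g {j} m" "fst (hd m) \<noteq> i" "fst (last m) \<noteq> i"
            using p(3) hd' \<open>m \<noteq> []\<close> bs'(2) by (auto simp: m alternating_append \<open>k = i\<close>)
          have q: "q \<in> talg {letter g {j} i}"
            using p(3) by (auto simp: m alternating_append alternating_Cons \<open>k = i\<close>)
          have "fst q * fst p \<in> unital_subalgebra hull {g i}"
            using fst_talg_letter[OF q] fst_talg_letter[OF p(1)] unital_subalgebra_hull[of "{g i}"]
            by (auto simp: unital_subalgebra_def)
          then have "\<phi> (block_prod m * (fst q * fst p)) = 0"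
            using alt \<open>m \<noteq> []\<close>
            by (intro alternating_right_zero[where J = "{j}" and i = i] IH) (auto simp: bs' m)
          then show ?thesis
            using phi_commute[of "fst p" "block_prod m * fst q"]
            by (simp add: bs' m block_prod_append tprod_append mult.assoc)
        qed
      qed
    qed
  qed
  then show ?thesis using free_family_iff_alternating by blast
qed

end

section \<open>Inverses and inverse square roots\<close>

context cstar_state
begin

text \<open>Since \<open>D V = 1 \<otimes> V\<close> gives \<open>D V\<^sup>-\<^sup>1 = - V\<^sup>-\<^sup>1 \<otimes> 1\<close>, the element \<open>V\<^sup>-\<^sup>1 X\<close> satisfies
  \<open>D (V\<^sup>-\<^sup>1 X) = - V\<^sup>-\<^sup>1 \<otimes> X + V\<^sup>-\<^sup>1 \<otimes> X = 0\<close>.  The inverse is approximated by the partial sums of a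
  Neumann series, which are polynomials in \<open>V\<close>.\<close>

lemma schwinger_dyson_inverse_mult:
  fixes g g' :: "bool \<Rightarrow> 'a"
  assumes words: "\<And>ws. schwinger_dyson V \<beta> \<alpha> (tprod (map (letter g UNIV) ws))"
    and V: "V = g True + g False"
    and c: "c > 0" and contraction: "norm (1 - scaleR (1 / c) V) < 1"
    and Vi: "Vi * V = 1" "V * Vi = 1"
    and g': "g' True = Vi * g True" "g' False = V"
  shows "schwinger_dyson V \<beta> \<alpha> (tprod (map (letter g' {False}) ws))"
proof -
  define X where "X = g True"
  define C where "C = complex_of_real (1 / c)"
  define E where "E = range (letter g UNIV)"
  have E: "bilinear_form (snd e)" if "e \<in> E" for e
    using that by (auto simp: E_def bilinear_letter)
  have sd: "schwinger_dyson V \<beta> \<alpha> p" if "p \<in> talg E" for p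
  proof (rule schwinger_dyson_talg[OF that E])
    fix ws assume "set ws \<subseteq> E"
    then have "\<exists>vs. ws = map (letter g UNIV) vs"
      by (induction ws) (auto simp: E_def intro: exI[of _ "_ # _"])
    then show "schwinger_dyson V \<beta> \<alpha> (tprod ws)" using words by auto
  qed
  define Vp where "Vp = tadd (letter g UNIV True) (letter g UNIV False)"
  have Vp_E: "Vp \<in> talg E"
    unfolding Vp_def by (intro talg.add talg_generator) (auto simp: E_def)
  have Vp: "fst Vp = V" "snd Vp u v = \<phi> u * \<phi> (V * v)" for u v
    by (simp_all add: Vp_def V snd_letter distrib_right distrib_left phi_add)
  define h where "h = 1 - scaleC C V"
  define hp where "hp = tadd tone (tscale (- C) Vp)"
  have hp_E: "hp \<in> talg E" unfolding hp_def by (intro talg.add talg.scale talg.one Vp_E)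
  have "scaleC (- C) V = - scaleC C V"
    by (simp add: eq_neg_iff_add_eq_0 scaleC_add_left[symmetric])
  then have hp: "fst hp = h" "snd hp u v = - C * (\<phi> u * \<phi> (V * v))" for u v
    by (simp_all add: hp_def h_def Vp)
  have norm_h: "norm h < 1"
    using contraction by (simp add: h_def C_def scaleR_conv_scaleC)
  have hV: "V * h = h * V"
    by (simp add: h_def left_diff_distrib right_diff_distrib mult_scaleC_left mult_scaleC_right)
  \<comment> \<open>The pair version of C (1 + h + ... + h^(n-1)), which tends to V^(-1);
    \<open>tscale 0 tone\<close> is the zero pair.\<close>
  define T where "T n = rec_nat (tscale 0 tone) (\<lambda>_ t. tadd (tscale C tone) (tmult hp t)) n" for n
  have T: "T 0 = tscale 0 tone" "T (Suc n) = tadd (tscale C tone) (tmult hp (T n))" for n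
    by (simp_all add: T_def)
  have T_E: "T n \<in> talg E" for n
  proof (induction n)
    case (Suc n)
    then show ?case unfolding T by (intro talg.add talg.scale talg.one talg_mult[OF hp_E] E)
  qed (auto simp: T intro: talg.scale talg.one)
  have VT: "V * fst (T n) = 1 - h ^ n" for n
  proof (induction n)
    case (Suc n)
    have "V * fst (T (Suc n)) = scaleC C V + h * (V * fst (T n))"
      by (simp add: T hp distrib_left mult_scaleC_right mult.assoc[symmetric] hV)
    also have "scaleC C V = 1 - h" by (simp add: h_def)
    finally show ?case unfolding Suc by (simp add: right_diff_distrib)
  qed (simp add: T)
  \<comment> \<open>The first term is the truncated form of \<open>- V^(-1) \<otimes> 1\<close>; the
    sum is the truncation error.\<close>
  have snd_T: "snd (T n) u v = - (\<phi> (u * fst (T n)) * \<phi> v)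
      + C * (\<Sum>k<n. \<phi> (u * h ^ k) * \<phi> (h ^ (n - Suc k) * v))" for n u v
  proof (induction n arbitrary: u)
    case 0
    then show ?case by (simp add: T phi_zero)
  next
    case (Suc n)
    have 1: "\<phi> (V * (fst (T n) * v)) = \<phi> v - \<phi> (h ^ n * v)"
      by (simp add: mult.assoc[symmetric] VT left_diff_distrib phi_diff)
    have 2: "\<phi> (u * fst (T (Suc n))) = C * \<phi> u + \<phi> (u * h * fst (T n))"
      by (simp add: T hp distrib_left mult_scaleC_right phi_add phi_scaleC mult.assoc)
    have 3: "(\<Sum>k<Suc n. \<phi> (u * h ^ k) * \<phi> (h ^ (Suc n - Suc k) * v))
        = \<phi> u * \<phi> (h ^ n * v) + (\<Sum>k<n. \<phi> (u * h * h ^ k) * \<phi> (h ^ (n - Suc k) * v))"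
      by (subst sum.lessThan_Suc_shift) (simp add: mult.assoc)
    have "snd (T (Suc n)) u v = snd hp u (fst (T n) * v) + snd (T n) (u * h) v"
      by (simp add: T hp(1))
    also have "\<dots> = - C * (\<phi> u * (\<phi> v - \<phi> (h ^ n * v))) - \<phi> (u * h * fst (T n)) * \<phi> v
      + C * (\<Sum>k<n. \<phi> (u * h * h ^ k) * \<phi> (h ^ (n - Suc k) * v))"
      unfolding hp(2) 1 Suc by simp
    also have "\<dots> = - (\<phi> (u * fst (T (Suc n))) * \<phi> v)
      + C * (\<Sum>k<Suc n. \<phi> (u * h ^ k) * \<phi> (h ^ (Suc n - Suc k) * v))"
      unfolding 2 3 by (simp add: algebra_simps)
    finally show ?case .
  qed
  define W where "W n = tmult (T (Suc n)) (letter g UNIV True)" for n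
  have W_E: "W n \<in> talg E" for n
    unfolding W_def by (intro talg_mult T_E E talg_generator) (auto simp: E_def)
  \<comment> \<open>The main term of \<open>D (T (Suc n))\<close> cancels against the derivative of
    X. What remains are n + 1 error terms with total exponent n in h, hence a bound of order (n + 1)
    times the n-th power of \<open>norm h\<close>.\<close>
  have snd_W: "snd (W n) u v = C * (\<Sum>k<Suc n. \<phi> (u * h ^ k) * \<phi> (h ^ (n - k) * (X * v)))" for n u v
    by (simp add: W_def snd_T snd_letter X_def del: sum.lessThan_Suc)
  have norm_W: "cmod (snd (W n) u v) \<le> real (Suc n) * norm h ^ n * (4 * cmod C * norm X * norm u * norm v)"
    for n u v
  proof -
    have "cmod (\<phi> (u * h ^ k) * \<phi> (h ^ (n - k) * (X * v))) \<le> 4 * norm h ^ n * norm X * norm u * norm v"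
      if "k < Suc n" for k
    proof -
      have "cmod (\<phi> (u * h ^ k)) \<le> 2 * (norm u * norm h ^ k)"
        by (rule order_trans[OF norm_phi_le mult_left_mono])
          (auto intro: order_trans[OF norm_mult_ineq mult_left_mono] norm_power_ineq)
      moreover have "cmod (\<phi> (h ^ (n - k) * (X * v))) \<le> 2 * (norm h ^ (n - k) * (norm X * norm v))"
        by (rule order_trans[OF norm_phi_le mult_left_mono])
          (auto intro!: order_trans[OF norm_mult_ineq mult_mono] norm_power_ineq norm_mult_ineq)
      ultimately have "cmod (\<phi> (u * h ^ k)) * cmod (\<phi> (h ^ (n - k) * (X * v)))
        \<le> 2 * (norm u * norm h ^ k) * (2 * (norm h ^ (n - k) * (norm X * norm v)))"
        by (intro mult_mono) auto
      also have "\<dots> = 4 * (norm h ^ k * norm h ^ (n - k)) * norm X * norm u * norm v"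
        by simp
      also have "norm h ^ k * norm h ^ (n - k) = norm h ^ n"
        using that by (simp add: power_add[symmetric])
      finally show ?thesis by (simp add: norm_mult)
    qed
    then have "cmod (\<Sum>k<Suc n. \<phi> (u * h ^ k) * \<phi> (h ^ (n - k) * (X * v)))
      \<le> (\<Sum>k<Suc n. 4 * norm h ^ n * norm X * norm u * norm v)"
      by (intro sum_norm_le) auto
    also have "\<dots> = real (Suc n) * (4 * norm h ^ n * norm X * norm u * norm v)" by simp
    finally have "cmod C * cmod (\<Sum>k<Suc n. \<phi> (u * h ^ k) * \<phi> (h ^ (n - k) * (X * v)))
      \<le> cmod C * (real (Suc n) * (4 * norm h ^ n * norm X * norm u * norm v))"
      by (rule mult_left_mono) simp
    then show ?thesis by (simp add: snd_W norm_mult mult_ac del: sum.lessThan_Suc of_nat_Suc)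
  qed
  have n_h: "(\<lambda>n. real (Suc n) * norm h ^ n) \<longlonglongrightarrow> 0"
  proof -
    have "(\<lambda>n. real n * norm h ^ n + norm h ^ n) \<longlonglongrightarrow> 0 + 0"
      using norm_h by (intro tendsto_add powser_times_n_limit_0 LIMSEQ_power_zero) auto
    then show ?thesis by (simp add: algebra_simps)
  qed
  \<comment> \<open>The arguments move with n because the neighbouring letters of a word are
    approximated at the same time.\<close>
  have snd_W_lim: "(\<lambda>n. snd (W n) (u n) (v n)) \<longlonglongrightarrow> 0"
    if "u \<longlonglongrightarrow> u'" "v \<longlonglongrightarrow> v'" for u v u' v'
  proof (rule Lim_null_comparison)
    show "\<forall>\<^sub>F n in sequentially. cmod (snd (W n) (u n) (v n))
        \<le> real (Suc n) * norm h ^ n * (4 * cmod C * norm X * norm (u n) * norm (v n))"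
      by (intro always_eventually allI norm_W)
    have "(\<lambda>n. real (Suc n) * norm h ^ n * (4 * cmod C * norm X * norm (u n) * norm (v n)))
        \<longlonglongrightarrow> 0 * (4 * cmod C * norm X * norm u' * norm v')"
      using that by (intro tendsto_intros n_h)
    then show "(\<lambda>n. real (Suc n) * norm h ^ n * (4 * cmod C * norm X * norm (u n) * norm (v n))) \<longlonglongrightarrow> 0"
      by simp
  qed
  have "fst (T n) = Vi - Vi * h ^ n" for n
    using arg_cong[OF VT[of n], of "\<lambda>x. Vi * x"]
    by (simp add: mult.assoc[symmetric] Vi right_diff_distrib)
  then have "fst (W n) = (Vi - Vi * (h * h ^ n)) * X" for n
    by (simp add: W_def X_def)
  moreover have "(\<lambda>n. (Vi - Vi * (h * h ^ n)) * X) \<longlonglongrightarrow> (Vi - Vi * (h * 0)) * X"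
    by (intro tendsto_intros LIMSEQ_power_zero norm_h)
  ultimately have fst_W_lim: "(\<lambda>n. fst (W n)) \<longlonglongrightarrow> Vi * X"
    by simp
  define L where "L n b = (if b then W n else Vp)" for n b
  have L_E: "tprod (map (L n) ws) \<in> talg E" for n ws
  proof (rule talg_tprod[OF _ E])
    fix p assume "p \<in> set (map (L n) ws)"
    then obtain b where "p = L n b" by auto
    with W_E Vp_E show "p \<in> talg E" by (simp add: L_def)
  qed
  have fst_L: "(\<lambda>n. fst (L n b)) \<longlonglongrightarrow> g' b" for b
    by (cases b) (simp_all add: L_def g' Vp fst_W_lim[unfolded X_def])
  have fst_lim: "(\<lambda>n. fst (tprod (map (L n) ws))) \<longlonglongrightarrow> fst (tprod (map (letter g' {False}) ws))" for ws
    by (induction ws) (auto intro!: tendsto_mult fst_L)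
  have phi_lim: "(\<lambda>n. \<phi> (x n)) \<longlonglongrightarrow> \<phi> y" if "x \<longlonglongrightarrow> y" for x y
    by (rule bounded_linear.tendsto[OF bounded_linear_phi that])
  have snd_L: "(\<lambda>n. snd (L n b) (u n) (v n)) \<longlonglongrightarrow> snd (letter g' {False} b) u' v'"
    if "u \<longlonglongrightarrow> u'" "v \<longlonglongrightarrow> v'" for b u v u' v'
  proof (cases b)
    case True
    then show ?thesis using snd_W_lim[OF that] by (simp add: L_def snd_letter)
  next
    case False
    then show ?thesis using that by (auto simp: L_def Vp snd_letter g' intro!: tendsto_intros phi_lim)
  qed
  have snd_lim: "(\<lambda>n. snd (tprod (map (L n) ws)) (u n) (v n))
      \<longlonglongrightarrow> snd (tprod (map (letter g' {False}) ws)) u' v'"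
    if "u \<longlonglongrightarrow> u'" "v \<longlonglongrightarrow> v'" for ws u v u' v'
    using that(1)
  proof (induction ws arbitrary: u u')
    case (Cons b ws)
    have "(\<lambda>n. snd (L n b) (u n) (fst (tprod (map (L n) ws)) * v n)
        + snd (tprod (map (L n) ws)) (u n * fst (L n b)) (v n))
      \<longlonglongrightarrow> snd (letter g' {False} b) u' (fst (tprod (map (letter g' {False}) ws)) * v')
        + snd (tprod (map (letter g' {False}) ws)) (u' * g' b) v'"
      by (intro tendsto_add snd_L Cons tendsto_mult fst_lim that fst_L)
    then show ?case by simp
  qed simp
  have "(\<lambda>n. \<phi> (V * fst (tprod (map (L n) ws)))) \<longlonglongrightarrow> \<phi> (V * fst (tprod (map (letter g' {False}) ws)))"
    by (intro phi_lim tendsto_mult tendsto_const fst_lim)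
  moreover have "(\<lambda>n. \<phi> (V * fst (tprod (map (L n) ws)))) \<longlonglongrightarrow>
      \<beta> * \<phi> (fst (tprod (map (letter g' {False}) ws)))
      + \<alpha> * snd (tprod (map (letter g' {False}) ws)) 1 1"
    using sd[OF L_E] unfolding schwinger_dyson_def
    by (simp only:) (intro tendsto_intros phi_lim fst_lim snd_lim)
  ultimately show ?thesis
    unfolding schwinger_dyson_def by (rule LIMSEQ_unique)
qed

end

section \<open>Invariance of freeness under conjugation\<close>

context tracial_state
begin

text \<open>The map sending a to \<open>S * a * R\<close> is multiplicative and unital, preserves
  \<phi> by traciality, and carries each conjugated hull into the original one.\<close>

lemma free_family_conjugate:
  assumes free: "free_family \<phi> UNIV (\<lambda>i. unital_subalgebra hull {g i})"
    and RS: "R * S = 1" "S * R = 1"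
  shows "free_family \<phi> UNIV (\<lambda>i. unital_subalgebra hull {R * g i * S})"
  unfolding free_family_def
proof (intro allI impI)
  fix w :: "('b \<times> 'a) list"
  assume w: "w \<noteq> [] \<and> (\<forall>(i, a)\<in>set w. i \<in> UNIV \<and> a \<in> unital_subalgebra hull {R * g i * S} \<and> \<phi> a = 0) \<and>
    distinct_adj (map fst w)"
  have phi_conj: "\<phi> (S * a * R) = \<phi> a" for a
    using phi_commute[of "S * a" R] by (simp add: mult.assoc[symmetric] RS)
  have RS': "R * (S * a) = a" "S * (R * a) = a" for a
    by (simp_all add: mult.assoc[symmetric] RS)
  have hull: "S * a * R \<in> unital_subalgebra hull {g i}"
    if a: "a \<in> unital_subalgebra hull {R * g i * S}" for a i
  proof -
    define H where "H = unital_subalgebra hull {g i}"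
    define B where "B = {a. S * a * R \<in> H}"
    have g: "g i \<in> H"
      unfolding H_def using hull_subset[of "{g i}" unital_subalgebra] by auto
    have "unital_subalgebra H" unfolding H_def by (rule unital_subalgebra_hull)
    then have one: "1 \<in> H" and closed: "x + y \<in> H" "x * y \<in> H" "scaleC c x \<in> H"
      if "x \<in> H" "y \<in> H" for c x y
      using that by (auto simp: unital_subalgebra_def)
    have "1 \<in> B" using one[OF g g] by (simp add: B_def RS)
    moreover have "x + y \<in> B \<and> x * y \<in> B" if "x \<in> B" "y \<in> B" for x y
      using closed(1,2)[of "S * x * R" "S * y * R"] that
      by (simp add: B_def distrib_left distrib_right mult.assoc RS')
    moreover have "scaleC c x \<in> B" if "x \<in> B" for c x
      using closed(3)[of "S * x * R"] that by (simp add: B_def mult_scaleC_left mult_scaleC_right)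
    ultimately have "unital_subalgebra B" unfolding unital_subalgebra_def by blast
    moreover have "{R * g i * S} \<subseteq> B" by (simp add: B_def mult.assoc RS RS' g)
    ultimately have "unital_subalgebra hull {R * g i * S} \<subseteq> B"
      by (intro hull_minimal[where S = unital_subalgebra])
    with a show ?thesis by (auto simp: B_def H_def)
  qed
  define w' where "w' = map (\<lambda>b. (fst b, S * snd b * R)) w"
  have w': "map fst w' = map fst w" "w' \<noteq> []" using w by (simp_all add: w'_def)
  have "\<forall>(i, a)\<in>set w'. i \<in> UNIV \<and> a \<in> unital_subalgebra hull {g i} \<and> \<phi> a = 0"
    using w by (auto simp: w'_def phi_conj split_beta intro: hull)
  moreover have "distinct_adj (map fst w')" using w by (simp add: w')
  ultimately have "\<phi> (prod_list (map snd w')) = 0"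
    by (intro free[unfolded free_family_def, THEN spec, THEN mp] conjI w')
  moreover have "prod_list (map snd w') = S * prod_list (map snd w) * R"
    unfolding w'_def by (induction w) (simp_all add: RS RS' mult.assoc)
  ultimately show "\<phi> (prod_list (map snd w)) = 0" by (simp add: phi_conj)
qed

end

text \<open>Two successive roots give e = v^(1/4) for v = V / c. Its inverse d is selfadjoint, so
  d^2 = v^(-1/2) is visibly of the form required for positivity. The commutation clause is what the
  uniqueness proof uses.\<close>

lemma positive_inv_sqrt_exists:
  fixes V :: "'a::cstar_algebra"
  assumes V: "selfadjoint V" and c: "c > 0" and contraction: "norm (1 - scaleR (1 / c) V) < 1"
  obtains s where "cstar_positive s" "s * s * V = 1" "V * (s * s) = 1"
    "\<And>z. z * V = V * z \<Longrightarrow> z * s = s * z"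
proof -
  define v where "v = scaleR (1 / c) V"
  have Vv: "V = scaleR c v" using c by (simp add: v_def)
  have v: "selfadjoint v" unfolding v_def by (rule selfadjoint_scaleR[OF V])
  have nv: "norm (1 - v) < 1" using contraction by (simp add: v_def)
  obtain t where t: "selfadjoint t" "t * t = v" "norm (1 - t) \<le> 1"
      "\<And>z. z * v = v * z \<Longrightarrow> z * t = t * z"
    using selfadjoint_sqrt[OF v less_imp_le[OF nv]] by blast
  obtain e where e: "selfadjoint e" "e * e = t" "\<And>z. z * t = t * z \<Longrightarrow> z * e = e * z"
    using selfadjoint_sqrt[OF t(1,3)] by blast
  have comm_e: "z * e = e * z" if "z * v = v * z" for z
    using that by (intro e(3) t(4))
  define k where "k = (\<Sum>n. (1 - v) ^ n)"
  have sk: "summable (\<lambda>n. (1 - v) ^ n)" by (rule complete_algebra_summable_geometric[OF nv])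
  have "(1 - v) * k = (\<Sum>n. (1 - v) ^ Suc n)"
    unfolding k_def using suminf_mult[OF sk, of "1 - v"] by simp
  also have "\<dots> = k - 1"
    unfolding k_def using suminf_minus_initial_segment[OF sk, of 1] by simp
  finally have vk: "v * k = 1" by (simp add: left_diff_distrib)
  have comm_k: "z * k = k * z" if "z * v = v * z" for z
  proof -
    have "z * (1 - v) = (1 - v) * z" using that by (simp add: algebra_simps)
    then have "z * (1 - v) ^ n = (1 - v) ^ n * z" for n
      by (rule power_commuting_commutes[symmetric, OF sym])
    then show ?thesis
      unfolding k_def using suminf_mult[OF sk, of z] suminf_mult2[OF sk, of z] by simp
  qed
  have kv: "k * v = 1" using comm_k[of v] vk by simp
  have "adj k * v = adj (v * k)" using v by (simp add: adj_mult selfadjoint_def)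
  then have "adj k * v = 1" by (simp add: vk)
  have "adj k = adj k * (v * k)" by (simp add: vk)
  also have "\<dots> = k" using \<open>adj k * v = 1\<close> by (simp add: mult.assoc[symmetric])
  finally have "adj k = k" .
  have ev: "e * v = v * e" by (simp add: t(2)[symmetric] e(2)[symmetric] mult.assoc)
  have ek: "e * k = k * e" by (rule comm_k[OF ev])
  \<comment> \<open>With k = v^(-1) = e^(-4), this is e^(-1).\<close>
  define d where "d = e * (e * (e * k))"
  have ke: "k * (e * z) = e * (k * z)" for z
    by (simp add: mult.assoc[symmetric] ek)
  have d: "selfadjoint d"
    using e(1) \<open>adj k = k\<close> by (simp add: d_def selfadjoint_def adj_mult mult.assoc ke ek)
  have eeee: "e * (e * (e * e)) = v" by (simp add: t(2)[symmetric] e(2)[symmetric] mult.assoc)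
  have eeeek: "e * (e * (e * (e * k))) = 1"
    using vk by (simp add: eeee[symmetric] mult.assoc)
  have ed: "e * d = 1" by (simp add: d_def eeeek)
  have de: "d * e = 1" by (simp add: d_def mult.assoc ek[symmetric] eeeek)
  have comm_d: "z * d = d * z" if "z * v = v * z" for z
  proof -
    have "z * (e * x) = e * (z * x)" for x
      by (simp add: mult.assoc[symmetric] comm_e[OF that])
    then have "d * z * (e * d) = (d * e) * z * d" by (simp add: mult.assoc)
    then show ?thesis by (simp add: ed de)
  qed
  define s where "s = scaleR (1 / sqrt c) (d * d)"
  have cancel: "d * (e * z) = z" "e * (d * z) = z" for z
    by (simp_all add: mult.assoc[symmetric] ed de)
  have dddd: "d * (d * (d * (d * v))) = 1" "v * (d * (d * (d * d))) = 1"
    by (simp_all add: eeee[symmetric] mult.assoc cancel ed de)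
  have sc: "1 / sqrt c * (1 / sqrt c) * c = 1" using c by (simp add: field_simps)
  have "s * s * V = scaleR (1 / sqrt c * (1 / sqrt c) * c) (d * (d * (d * (d * v))))"
    "V * (s * s) = scaleR (1 / sqrt c * (1 / sqrt c) * c) (v * (d * (d * (d * d))))"
    by (simp_all add: s_def Vv mult.assoc mult.commute)
  then have "s * s * V = 1" "V * (s * s) = 1"
    by (simp_all only: dddd sc scaleR_one)
  moreover have "cstar_positive s"
    unfolding cstar_positive_def
  proof (rule exI[of _ "scaleR (sqrt (1 / sqrt c)) d"])
    show "s = adj (scaleR (sqrt (1 / sqrt c)) d) * scaleR (sqrt (1 / sqrt c)) d"
      using d c by (simp add: s_def adj_scaleR selfadjoint_def)
  qed
  moreover have "z * s = s * z" if "z * V = V * z" for z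
  proof -
    have "z * d = d * z" using that c by (intro comm_d) (simp add: Vv)
    then have "z * (d * d) = (d * d) * z" by (metis mult.assoc)
    then show ?thesis by (simp add: s_def)
  qed
  ultimately show ?thesis using that by blast
qed

section \<open>Uniqueness of the positive inverse square root\<close>

context faithful_tracial_state
begin

text \<open>The description operator needs uniqueness. A second candidate s commutes with V, hence
  with r, so f = s - r satisfies f (s + r) = 0. Then f s f and f r f are positive with sum 0;
  faithfulness gives r f = 0, and r is invertible.\<close>

lemma cstar_inv_sqrt_mult:
  fixes V :: 'a
  assumes V: "selfadjoint V" and c: "c > 0" and contraction: "norm (1 - scaleR (1 / c) V) < 1"
  shows "cstar_inv_sqrt V * cstar_inv_sqrt V * V = 1" "V * (cstar_inv_sqrt V * cstar_inv_sqrt V) = 1"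
proof -
  obtain r where r: "cstar_positive r" "r * r * V = 1" "V * (r * r) = 1"
      "\<And>z. z * V = V * z \<Longrightarrow> z * r = r * z"
    using positive_inv_sqrt_exists[OF assms] by blast
  obtain b where b: "r = adj b * b" using r(1) by (auto simp: cstar_positive_def)
  have uniq: "s = r" if s: "cstar_positive s" "s * s * V = 1" "V * (s * s) = 1" for s
  proof -
    obtain b' where b': "s = adj b' * b'" using s(1) by (auto simp: cstar_positive_def)
    have "s * V = (V * (s * s)) * (s * V)" by (simp add: s(3))
    also have "\<dots> = V * s * (s * s * V)" by (simp add: mult.assoc)
    also have "\<dots> = V * s" by (simp add: s(2))
    finally have "s * r = r * s" by (rule r(4))
    have "s * s = (r * r * V) * (s * s)" by (simp add: r(2))
    also have "\<dots> = r * r" by (simp only: mult.assoc s(3)[unfolded mult.assoc] mult_1_right)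
    finally have ss: "s * s = r * r" .
    define f where "f = s - r"
    have "adj f = f" by (simp add: f_def b b' adj_diff adj_mult adj_adj)
    have "f * (s + r) = 0"
      by (simp add: f_def algebra_simps ss \<open>s * r = r * s\<close>)
    moreover have "f * s * f + f * r * f = f * (s + r) * f"
      by (simp add: distrib_left distrib_right)
    ultimately have "f * s * f + f * r * f = 0" by simp
    moreover have "f * s * f = adj (b' * f) * (b' * f)" "f * r * f = adj (b * f) * (b * f)"
      by (simp_all add: b b' adj_mult \<open>adj f = f\<close> mult.assoc)
    ultimately have "\<phi> (adj (b' * f) * (b' * f)) + \<phi> (adj (b * f) * (b * f)) = 0"
      by (simp only: phi_add[symmetric] phi_zero)
    then have "\<phi> (adj (b * f) * (b * f)) = 0"
      using phi_adj_mult[of "b * f"] phi_adj_mult[of "b' * f"]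
      by (auto simp: complex_nonneg_Reals_iff complex_eq_iff)
    then have "b * f = 0" using faithful by (auto simp: faithful_def)
    then have "r * f = 0" by (simp add: b mult.assoc)
    have "f = V * (r * r) * f" by (simp add: r(3))
    also have "\<dots> = V * r * (r * f)" by (simp only: mult.assoc)
    finally have "f = 0" by (simp add: \<open>r * f = 0\<close>)
    then show ?thesis by (simp add: f_def)
  qed
  have "cstar_inv_sqrt V = r"
    unfolding cstar_inv_sqrt_def
  proof (rule the_equality)
    show "cstar_positive r \<and> r * r * V = 1 \<and> V * (r * r) = 1" using r(1-3) by simp
    show "s = r" if "cstar_positive s \<and> s * s * V = 1 \<and> V * (s * s) = 1" for s
      using that by (intro uniq) simp_all
  qed
  then show "cstar_inv_sqrt V * cstar_inv_sqrt V * V = 1"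
    "V * (cstar_inv_sqrt V * cstar_inv_sqrt V) = 1"
    using r(2,3) by simp_all
qed

end

section \<open>Moments of the free Poisson law\<close>

text \<open>Unnormalised moments of a semicircle law on [A, B]. Multiplying the Marchenko-Pastur
  density by x cancels its 1 / x and leaves this weight.\<close>

definition arc_moment :: "real \<Rightarrow> real \<Rightarrow> nat \<Rightarrow> real" where
  "arc_moment A B n = integral {A..B} (\<lambda>x. x ^ n * sqrt ((x - A) * (B - x)))"

lemma has_integral_arc_moment:
  "((\<lambda>x. x ^ n * sqrt ((x - A) * (B - x))) has_integral arc_moment A B n) {A..B}"
  unfolding arc_moment_def
  by (intro integrable_integral integrable_continuous_real continuous_intros)

text \<open>Integrate the derivative of \<open>x\<^sup>n ((x - A) (B - x))\<^sup>3\<^sup>/\<^sup>2\<close>, which vanishes at both end points.\<close>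

lemma arc_moment_recurrence:
  assumes "A < B"
  shows "(real n + 3) * arc_moment A B (Suc n)
    = (real n + 3 / 2) * (A + B) * arc_moment A B n - real n * (A * B) * arc_moment A B (n - 1)"
proof -
  define Q where "Q x = (x - A) * (B - x)" for x
  define F where "F x = x ^ n * (Q x * sqrt (Q x))" for x
  define F' where "F' x = - (real n + 3) * (x ^ Suc n * sqrt (Q x))
      + (real n + 3 / 2) * (A + B) * (x ^ n * sqrt (Q x))
      - real n * (A * B) * (x ^ (n - 1) * sqrt (Q x))" for x
  have "(F has_vector_derivative F' x) (at x)" if x: "x \<in> {A<..<B}" for x
  proof -
    have Qx: "Q x > 0" using x by (simp add: Q_def)
    have Q': "(Q has_real_derivative A + B - 2 * x) (at x)"
      unfolding Q_def by (auto intro!: derivative_eq_intros simp: algebra_simps)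
    define w where "w = sqrt (Q x)"
    have w: "w > 0" "Q x = w * w" using Qx by (simp_all add: w_def)
    have "((\<lambda>x. sqrt (Q x)) has_real_derivative (A + B - 2 * x) / (2 * w)) (at x)"
      by (rule DERIV_cong[OF DERIV_chain2[where f = sqrt, OF DERIV_real_sqrt[OF Qx] Q']])
        (use w(1) in \<open>simp add: w_def[symmetric] field_simps\<close>)
    then have "(F has_real_derivative (real n * x ^ (n - Suc 0)) * (Q x * sqrt (Q x))
        + ((A + B - 2 * x) * sqrt (Q x) + (A + B - 2 * x) / (2 * w) * Q x) * x ^ n) (at x)"
      unfolding F_def by (intro DERIV_mult DERIV_pow Q')
    also have "(A + B - 2 * x) * sqrt (Q x) + (A + B - 2 * x) / (2 * w) * Q x
        = 3 / 2 * (A + B - 2 * x) * sqrt (Q x)"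
      unfolding w_def[symmetric] w(2) using w(1) by (simp add: field_simps)
    also have "real n * x ^ (n - Suc 0) * (Q x * sqrt (Q x)) + 3 / 2 * (A + B - 2 * x) * sqrt (Q x) * x ^ n = F' x"
    proof (cases n)
      case 0
      then show ?thesis by (simp add: F'_def algebra_simps)
    next
      case (Suc m)
      have Q_eq: "Q x = - x * x + (A + B) * x - A * B" by (simp add: Q_def algebra_simps)
      have "real n * x ^ (n - Suc 0) * (Q x * sqrt (Q x)) + 3 / 2 * (A + B - 2 * x) * sqrt (Q x) * x ^ n
        = (real n * x ^ m * Q x + x ^ n * (3 / 2 * (A + B - 2 * x))) * sqrt (Q x)"
        by (simp add: Suc algebra_simps)
      also have "real n * x ^ m * Q x + x ^ n * (3 / 2 * (A + B - 2 * x))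
        = - (real n + 3) * x ^ Suc n + (real n + 3 / 2) * (A + B) * x ^ n - real n * (A * B) * x ^ m"
        unfolding Q_eq by (simp add: Suc algebra_simps)
      also have "(- (real n + 3) * x ^ Suc n + (real n + 3 / 2) * (A + B) * x ^ n
        - real n * (A * B) * x ^ m) * sqrt (Q x) = F' x"
        by (simp add: F'_def Suc algebra_simps)
      finally show ?thesis .
    qed
    finally show ?thesis by (simp add: has_real_derivative_iff_has_vector_derivative)
  qed
  moreover have "continuous_on {A..B} F"
    unfolding F_def Q_def by (intro continuous_intros)
  ultimately have "(F' has_integral F B - F A) {A..B}"
    using assms by (intro fundamental_theorem_of_calculus_interior) auto
  then have "(F' has_integral 0) {A..B}" by (simp add: F_def Q_def)
  moreover have "(F' has_integral - (real n + 3) * arc_moment A B (Suc n)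
      + (real n + 3 / 2) * (A + B) * arc_moment A B n
      - real n * (A * B) * arc_moment A B (n - 1)) {A..B}"
    unfolding F'_def Q_def
    by (intro has_integral_add has_integral_diff has_integral_mult_right has_integral_arc_moment)
  ultimately have "- (real n + 3) * arc_moment A B (Suc n)
      + (real n + 3 / 2) * (A + B) * arc_moment A B n
      - real n * (A * B) * arc_moment A B (n - 1) = 0"
    by (rule has_integral_unique[symmetric])
  then show ?thesis by linarith
qed

text \<open>The area of a half disc of radius (B - A) / 2.\<close>

lemma arc_moment_0:
  assumes "A < B"
  shows "arc_moment A B 0 = pi * (B - A)\<^sup>2 / 8"
proof -
  define a r where "a = (A + B) / 2" and "r = (B - A) / 2"
  have r: "r > 0" using assms by (simp add: r_def)
  define Q where "Q x = (x - A) * (B - x)" for x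
  have Q_eq: "Q x = r\<^sup>2 - (x - a)\<^sup>2" for x
    by (simp add: Q_def a_def r_def power2_eq_square field_simps)
  define F where "F x = (x - a) * sqrt (Q x) / 2 + r\<^sup>2 / 2 * arcsin ((x - a) / r)" for x
  have "(F has_vector_derivative x ^ 0 * sqrt (Q x)) (at x)" if x: "x \<in> {A<..<B}" for x
  proof -
    have Qx: "Q x > 0" using x by (simp add: Q_def)
    have in1: "-1 < (x - a) / r" "(x - a) / r < 1"
      using x r by (auto simp: a_def r_def field_simps)
    have Q': "(Q has_real_derivative - 2 * (x - a)) (at x)"
      unfolding Q_eq by (auto intro!: derivative_eq_intros)
    have sq: "sqrt (1 - ((x - a) / r)\<^sup>2) = sqrt (Q x) / r"
    proof -
      have "1 - ((x - a) / r)\<^sup>2 = Q x / r\<^sup>2" using r by (simp add: Q_eq field_simps)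
      then show ?thesis using r by (simp add: real_sqrt_divide)
    qed
    define w where "w = sqrt (Q x)"
    have w: "w > 0" "Q x = w * w" using Qx by (simp_all add: w_def)
    have "((\<lambda>x. sqrt (Q x)) has_real_derivative - (x - a) / w) (at x)"
      by (rule DERIV_cong[OF DERIV_chain2[where f = sqrt, OF DERIV_real_sqrt[OF Qx] Q']])
        (use w(1) in \<open>simp add: w_def[symmetric] field_simps\<close>)
    moreover have "((\<lambda>x. arcsin ((x - a) / r)) has_real_derivative 1 / w) (at x)"
      by (rule DERIV_cong[OF DERIV_chain2[where f = arcsin, OF DERIV_arcsin[OF in1]
            DERIV_cdivide[OF DERIV_diff[OF DERIV_ident DERIV_const]]]])
        (use r w(1) in \<open>simp add: sq w_def[symmetric]\<close>)
    ultimately have "(F has_real_derivative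
        ((1 - 0) * sqrt (Q x) + (- (x - a) / w) * (x - a)) / 2 + r\<^sup>2 / 2 * (1 / w)) (at x)"
      unfolding F_def
      by (intro DERIV_add DERIV_cmult DERIV_cdivide DERIV_mult DERIV_diff DERIV_ident DERIV_const)
    also have "((1 - 0) * sqrt (Q x) + (- (x - a) / w) * (x - a)) / 2 + r\<^sup>2 / 2 * (1 / w)
        = (w * w + (r\<^sup>2 - (x - a)\<^sup>2)) / (2 * w)"
      unfolding w_def[symmetric] using w(1) by (simp add: field_simps power2_eq_square)
    also have "\<dots> = x ^ 0 * sqrt (Q x)"
      unfolding Q_eq[symmetric] w_def[symmetric] w(2) using w(1) by (simp add: field_simps)
    finally show ?thesis by (simp add: has_real_derivative_iff_has_vector_derivative)
  qed
  moreover have "continuous_on {A..B} F"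
    unfolding F_def Q_def using r
    by (intro continuous_intros) (auto simp: a_def r_def field_simps)
  ultimately have "((\<lambda>x. x ^ 0 * sqrt (Q x)) has_integral F B - F A) {A..B}"
    using assms by (intro fundamental_theorem_of_calculus_interior) auto
  then have "arc_moment A B 0 = F B - F A"
    unfolding Q_def using has_integral_arc_moment has_integral_unique by blast
  moreover have ends: "(B - a) / r = 1" "(A - a) / r = -1"
    using r assms by (auto simp: a_def r_def field_simps)
  have "F B = r\<^sup>2 / 2 * (pi / 2)" "F A = - (r\<^sup>2 / 2 * (pi / 2))"
    unfolding F_def ends by (simp_all add: Q_def arcsin_minus_1)
  ultimately have "arc_moment A B 0 = pi * r\<^sup>2 / 2" by simp
  then show ?thesis by (simp add: r_def power_divide)
qed

text \<open>It supplies the total mass of the Marchenko-Pastur density, whose 1 / x does not cancel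
  in the zeroth moment.\<close>

lemma has_integral_arc_inverse:
  assumes "0 < A" "A < B"
  shows "((\<lambda>x. sqrt ((x - A) * (B - x)) / x) has_integral pi * ((A + B) / 2 - sqrt (A * B))) {A..B}"
proof -
  define a r where "a = (A + B) / 2" and "r = (B - A) / 2"
  have r: "r > 0" using assms by (simp add: r_def)
  define Q where "Q x = (x - A) * (B - x)" for x
  have Q_eq: "Q x = r\<^sup>2 - (x - a)\<^sup>2" for x
    by (simp add: Q_def a_def r_def power2_eq_square field_simps)
  have Q_eq2: "Q x = 2 * a * x - x * x - A * B" for x
    by (simp add: Q_def a_def algebra_simps)
  \<comment> \<open>The involution sending x to A B / x swaps the end points; y is the normalised
    coordinate of the image, with reversed sign so that it increases from -1 to 1.\<close>
  define y where "y x = (a - A * B / x) / r" for x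
  have AB: "A * B > 0" using assms by simp
  have y_sq: "1 - (y x)\<^sup>2 = A * B * Q x / (r * x)\<^sup>2" if "x > 0" for x
  proof -
    have "a\<^sup>2 - r\<^sup>2 = A * B" by (simp add: a_def r_def power2_eq_square field_simps)
    then have rr: "r\<^sup>2 = a\<^sup>2 - A * B" by simp
    have "(r * x)\<^sup>2 * (1 - (y x)\<^sup>2) = (r * x)\<^sup>2 - (a * x - A * B)\<^sup>2"
      using r that by (simp add: y_def field_simps power2_eq_square)
    also have "\<dots> = A * B * Q x"
      by (simp add: power_mult_distrib rr Q_eq2) (simp add: algebra_simps power2_eq_square)
    finally have "(r * x)\<^sup>2 * (1 - (y x)\<^sup>2) = A * B * Q x" .
    moreover have "(r * x)\<^sup>2 \<noteq> 0" using r that by simp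
    ultimately show ?thesis by (metis nonzero_mult_div_cancel_left)
  qed
  have y_bound: "-1 \<le> y x \<and> y x \<le> 1" if "x \<in> {A..B}" for x
  proof -
    have "0 \<le> 1 - (y x)\<^sup>2"
      using that assms AB by (subst y_sq) (auto simp: Q_def)
    then have "\<bar>y x\<bar> \<le> 1" by (simp add: abs_square_le_1)
    then show ?thesis by auto
  qed
  define F where "F x = sqrt (Q x) + a * arcsin ((x - a) / r) - sqrt (A * B) * arcsin (y x)" for x
  have "(F has_vector_derivative sqrt (Q x) / x) (at x)" if x: "x \<in> {A<..<B}" for x
  proof -
    have Qx: "Q x > 0" and x0: "x > 0" using x assms by (auto simp: Q_def)
    have in1: "-1 < (x - a) / r" "(x - a) / r < 1"
      using x r by (auto simp: a_def r_def field_simps)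
    have "(y x)\<^sup>2 < 1"
      using y_sq[OF x0] AB Qx r x0 by (smt (verit) divide_pos_pos mult_pos_pos zero_less_power)
    then have in2: "-1 < y x" "y x < 1" by (auto simp: abs_square_less_1 abs_less_iff)
    have Q': "(Q has_real_derivative - 2 * (x - a)) (at x)"
      unfolding Q_eq by (auto intro!: derivative_eq_intros)
    have y': "(y has_real_derivative A * B / (r * x\<^sup>2)) (at x)"
      unfolding y_def using x0 r
      by (auto intro!: derivative_eq_intros simp: field_simps power2_eq_square)
    have sq: "sqrt (1 - ((x - a) / r)\<^sup>2) = sqrt (Q x) / r"
    proof -
      have "1 - ((x - a) / r)\<^sup>2 = Q x / r\<^sup>2" using r by (simp add: Q_eq field_simps)
      then show ?thesis using r by (simp add: real_sqrt_divide)
    qed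
    have sq2: "sqrt (1 - (y x)\<^sup>2) = sqrt (A * B) * sqrt (Q x) / (r * x)"
      using r x0 by (simp add: y_sq real_sqrt_divide real_sqrt_mult)
    define w where "w = sqrt (Q x)"
    have w: "w > 0" "Q x = w * w" using Qx by (simp_all add: w_def)
    have "((\<lambda>x. sqrt (Q x)) has_real_derivative - (x - a) / w) (at x)"
      by (rule DERIV_cong[OF DERIV_chain2[where f = sqrt, OF DERIV_real_sqrt[OF Qx] Q']])
        (use w(1) in \<open>simp add: w_def[symmetric] field_simps\<close>)
    moreover have "((\<lambda>x. arcsin ((x - a) / r)) has_real_derivative 1 / w) (at x)"
      by (rule DERIV_cong[OF DERIV_chain2[where f = arcsin, OF DERIV_arcsin[OF in1]
            DERIV_cdivide[OF DERIV_diff[OF DERIV_ident DERIV_const]]]])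
        (use r w(1) in \<open>simp add: sq w_def[symmetric]\<close>)
    moreover have "((\<lambda>x. arcsin (y x)) has_real_derivative sqrt (A * B) / (x * w)) (at x)"
    proof (rule DERIV_cong[OF DERIV_chain2[where f = arcsin, OF DERIV_arcsin[OF in2] y']])
      have "A * B = sqrt (A * B) * sqrt (A * B)" using AB by simp
      then have "inverse (sqrt (A * B) * w / (r * x)) * (A * B / (r * x\<^sup>2))
        = inverse (sqrt (A * B) * w / (r * x)) * (sqrt (A * B) * sqrt (A * B) / (r * x\<^sup>2))"
        by simp
      also have "\<dots> = sqrt (A * B) / (x * w)"
        using r x0 w(1) AB by (simp add: field_simps power2_eq_square del: real_sqrt_mult_self)
      finally show "inverse (sqrt (1 - (y x)\<^sup>2)) * (A * B / (r * x\<^sup>2)) = sqrt (A * B) / (x * w)"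
        by (simp add: sq2 w_def)
    qed
    ultimately have "(F has_real_derivative
        - (x - a) / w + a * (1 / w) - sqrt (A * B) * (sqrt (A * B) / (x * w))) (at x)"
      unfolding F_def by (intro DERIV_add DERIV_diff DERIV_cmult)
    also have "- (x - a) / w + a * (1 / w) - sqrt (A * B) * (sqrt (A * B) / (x * w))
        = (2 * a * x - x * x - A * B) / (x * w)"
      using x0 w(1) AB by (simp add: field_simps)
    also have "\<dots> = sqrt (Q x) / x"
      unfolding Q_eq2[symmetric] w_def[symmetric] w(2) using w(1) x0 by (simp add: field_simps)
    finally show ?thesis by (simp add: has_real_derivative_iff_has_vector_derivative)
  qed
  moreover have "continuous_on {A..B} F"
    unfolding F_def
  proof (intro continuous_intros ballI)
    show "continuous_on {A..B} Q" unfolding Q_def by (intro continuous_intros)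
    show "continuous_on {A..B} y" unfolding y_def using assms r by (intro continuous_intros) auto
    show "-1 \<le> (x - a) / r \<and> (x - a) / r \<le> 1" if "x \<in> {A..B}" for x
      using that r by (auto simp: a_def r_def field_simps)
  qed (use r y_bound in auto)
  ultimately have "((\<lambda>x. sqrt (Q x) / x) has_integral F B - F A) {A..B}"
    using assms by (intro fundamental_theorem_of_calculus_interior) auto
  moreover have ends: "(B - a) / r = 1" "(A - a) / r = -1" "y B = 1" "y A = -1"
    using r assms by (auto simp: a_def r_def y_def field_simps)
  have "F B = a * (pi / 2) - sqrt (A * B) * (pi / 2)" "F A = - (a * (pi / 2) - sqrt (A * B) * (pi / 2))"
    unfolding F_def ends by (simp_all add: Q_def arcsin_minus_1)
  then have "F B - F A = pi * (a - sqrt (A * B))" by (simp add: algebra_simps)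
  ultimately show ?thesis by (simp add: Q_def a_def)
qed

text \<open>With q = 1 - s z + p z^2 the recurrence reads 2 q T' = q' T. Hence T^2 / q has
  derivative 0 and constant term 1: T is the square root of q.\<close>

lemma generating_function_square:
  fixes t :: "nat \<Rightarrow> real"
  assumes t0: "t 0 = 1" and t1: "t 1 = - s / 2" and t2: "2 * t 2 = s / 2 * t 1 + p"
    and rec: "\<And>n. (real n + 3) * t (n + 3) = (real n + 3 / 2) * s * t (n + 2) - real n * p * t (n + 1)"
  shows "(Abs_fps t)\<^sup>2 = 1 - fps_const s * fps_X + fps_const p * fps_X\<^sup>2"
proof -
  define T where "T = Abs_fps t"
  define q where "q = 1 - fps_const s * fps_X + fps_const p * fps_X\<^sup>2"
  have q_nth: "fps_nth q k = (if k = 0 then 1 else if k = 1 then - s else if k = 2 then p else 0)" for k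
    by (simp add: q_def fps_X_power_nth)
  have q': "fps_deriv q = fps_const (- s) + fps_const (2 * p) * fps_X"
    by (rule fps_ext) (simp add: q_nth)
  have "q * fps_deriv T + q * fps_deriv T = fps_deriv q * T"
  proof (rule fps_ext)
    fix n
    have "q * fps_deriv T
        = fps_deriv T - fps_const s * (fps_X * fps_deriv T) + fps_const p * (fps_X\<^sup>2 * fps_deriv T)"
      by (simp add: q_def left_diff_distrib distrib_right mult.assoc)
    then have l: "fps_nth (q * fps_deriv T) n = fps_nth (fps_deriv T) n
        - s * (if n = 0 then 0 else fps_nth (fps_deriv T) (n - 1))
        + p * (if n < 2 then 0 else fps_nth (fps_deriv T) (n - 2))"
      by (simp only: fps_add_nth fps_sub_nth fps_mult_left_const_nth
          fps_X_mult_nth fps_X_power_mult_nth)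
    have "fps_deriv q * T = fps_const (- s) * T + fps_const (2 * p) * (fps_X * T)"
      unfolding q' by (simp only: distrib_right mult.assoc)
    then have r: "fps_nth (fps_deriv q * T) n = - s * fps_nth T n
        + 2 * p * (if n = 0 then 0 else fps_nth T (n - 1))"
      by (simp only: fps_add_nth fps_mult_left_const_nth fps_X_mult_nth)
    have d: "fps_nth (fps_deriv T) k = (real k + 1) * t (k + 1)" for k
      by (simp add: T_def)
    have "2 * fps_nth (q * fps_deriv T) n = fps_nth (fps_deriv q * T) n"
    proof (cases "n < 2")
      case True
      then consider "n = 0" | "n = 1" by linarith
      then show ?thesis
        unfolding l r d using t0 t1 t2 by cases (simp_all add: T_def numeral_2_eq_2)
    next
      case False
      then obtain m where m: "n = m + 2" by (metis add.commute le_Suc_ex not_less)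
      have "real n + 1 = real m + 3" "n + 1 = m + 3" "n - 1 = m + 1" "n - 2 = m" "\<not> n = 0" "\<not> n < 2"
        "m + 1 + 1 = m + 2" "real (m + 1) + 1 = real m + 2"
        by (simp_all add: m)
      then have "2 * fps_nth (q * fps_deriv T) n - fps_nth (fps_deriv q * T) n
        = 2 * ((real m + 3) * t (m + 3)
          - ((real m + 3 / 2) * s * t (m + 2) - real m * p * t (m + 1)))"
        unfolding l r d by (simp add: m T_def numeral_3_eq_3 algebra_simps)
      then show ?thesis unfolding rec by simp
    qed
    then show "fps_nth (q * fps_deriv T + q * fps_deriv T) n = fps_nth (fps_deriv q * T) n"
      by (simp only: fps_add_nth mult_2)
  qed
  then have "(q * fps_deriv T + q * fps_deriv T) * T = fps_deriv q * (T * T)"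
    by (simp only: mult.assoc)
  moreover have "fps_deriv (T * T) = fps_deriv T * T + T * fps_deriv T"
    by (simp add: add.commute)
  ultimately have qT: "q * fps_deriv (T\<^sup>2) = fps_deriv q * T\<^sup>2"
    unfolding power2_eq_square by (simp only: distrib_left distrib_right mult.assoc mult.left_commute mult.commute)
  define R where "R = T\<^sup>2 * inverse q"
  have q0: "fps_nth q 0 \<noteq> 0" by (simp add: q_nth)
  have Rq: "T\<^sup>2 = R * q"
    using inverse_mult_eq_1[OF q0] by (simp add: R_def mult.assoc)
  have "fps_deriv (R * q) = R * fps_deriv q + fps_deriv R * q" by simp
  then have "q * (R * fps_deriv q + fps_deriv R * q) = fps_deriv q * (R * q)"
    using qT unfolding Rq by simp
  moreover have "q * (q * fps_deriv R) = q * (R * fps_deriv q + fps_deriv R * q) - fps_deriv q * (R * q)"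
    by (simp add: algebra_simps)
  ultimately have "q * (q * fps_deriv R) = 0" by (simp only: diff_self)
  moreover have "q \<noteq> 0" using q0 by auto
  ultimately have "fps_deriv R = 0" by (metis mult_eq_0_iff)
  then have "R = fps_const (fps_nth R 0)" by (simp add: fps_deriv_eq_0_iff)
  also have "fps_nth R 0 = 1"
    by (simp add: R_def power2_eq_square T_def t0 q_def)
  finally show ?thesis using Rq by (simp add: T_def q_def)
qed

text \<open>For the semicircle law with mean a and variance b, the linear recurrence identifies 1 -
  a z - 2 b z^2 C as a root of (1 - a z)^2 - 4 b z^2. Squaring gives C = 1 + a z C + b z^2 C^2,
  whose coefficients are the claim.\<close>

lemma arc_moment_convolution:
  assumes "A < B"
  defines "c \<equiv> \<lambda>n. arc_moment A B n / arc_moment A B 0"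
  shows "c (Suc n) = (A + B) / 2 * c n + (B - A)\<^sup>2 / 16 * (\<Sum>i<n. c i * c (n - Suc i))"
proof -
  define a b where "a = (A + B) / 2" and "b = (B - A)\<^sup>2 / 16"
  have b: "b > 0" using assms(1) by (simp add: b_def)
  have a2: "2 * a = A + B" by (simp add: a_def)
  have AB: "A * B = a\<^sup>2 - 4 * b" by (simp add: a_def b_def power2_eq_square field_simps)
  have "arc_moment A B 0 > 0" using assms(1) by (simp add: arc_moment_0)
  then have c0: "c 0 = 1" by (simp add: c_def)
  have c_rec: "(real n + 3) * c (Suc n) = (real n + 3 / 2) * (2 * a) * c n - real n * (A * B) * c (n - 1)" for n
  proof -
    have "(real n + 3) * c (Suc n) = ((real n + 3) * arc_moment A B (Suc n)) / arc_moment A B 0"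
      by (simp add: c_def)
    also have "\<dots> = (real n + 3 / 2) * (2 * a) * c n - real n * (A * B) * c (n - 1)"
      unfolding arc_moment_recurrence[OF assms(1)] a2 by (simp add: c_def diff_divide_distrib)
    finally show ?thesis .
  qed
  \<comment> \<open>The coefficients of 1 - a z - 2 b z^2 C.\<close>
  define t where "t n = (if n = 0 then 1 else if n = 1 then - a else - 2 * b * c (n - 2))" for n :: nat
  have "(Abs_fps t)\<^sup>2 = 1 - fps_const (2 * a) * fps_X + fps_const (A * B) * fps_X\<^sup>2"
  proof (rule generating_function_square)
    show "2 * t 2 = 2 * a / 2 * t 1 + A * B" by (simp add: t_def c0 AB power2_eq_square)
    fix n
    show "(real n + 3) * t (n + 3) = (real n + 3 / 2) * (2 * a) * t (n + 2) - real n * (A * B) * t (n + 1)"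
    proof (cases n)
      case 0
      then show ?thesis using c_rec[of 0] by (simp add: t_def numeral_3_eq_3)
    next
      case (Suc m)
      have "t (n + 3) = - 2 * b * c (Suc n)" "t (n + 2) = - 2 * b * c n" "t (n + 1) = - 2 * b * c (n - 1)"
        by (simp_all add: t_def Suc numeral_3_eq_3)
      moreover have "- 2 * b * ((real n + 3) * c (Suc n))
          = - 2 * b * ((real n + 3 / 2) * (2 * a) * c n - real n * (A * B) * c (n - 1))"
        by (simp only: c_rec)
      ultimately show ?thesis by (simp add: algebra_simps)
    qed
  qed (simp_all add: t_def)
  moreover define C where "C = Abs_fps c"
  have "Abs_fps t = 1 - fps_const a * fps_X - 2 * fps_const b * fps_X\<^sup>2 * C"
    by (rule fps_ext)
      (auto simp: t_def C_def numeral_fps_const mult.assoc fps_X_power_mult_nth fps_X_nth)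
  ultimately have "(1 - fps_const a * fps_X - 2 * fps_const b * fps_X\<^sup>2 * C)\<^sup>2
      = (1 - fps_const a * fps_X)\<^sup>2 - 4 * fps_const b * fps_X\<^sup>2"
    by (simp add: AB power2_eq_square algebra_simps fps_const_mult[symmetric] fps_const_sub[symmetric]
        numeral_fps_const[symmetric] del: fps_const_mult fps_const_sub)
  moreover have "4 * k * x\<^sup>2 * (1 + u * x * C + k * x\<^sup>2 * C\<^sup>2 - C)
      = (1 - u * x - 2 * k * x\<^sup>2 * C)\<^sup>2 - ((1 - u * x)\<^sup>2 - 4 * k * x\<^sup>2)" for k x u C :: "real fps"
    by (simp add: algebra_simps power2_eq_square)
  ultimately have "4 * fps_const b * fps_X\<^sup>2
      * (1 + fps_const a * fps_X * C + fps_const b * fps_X\<^sup>2 * C\<^sup>2 - C) = 0"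
    by simp
  moreover have "4 * fps_const b * fps_X\<^sup>2 \<noteq> (0 :: real fps)"
    using b by (simp add: numeral_fps_const)
  ultimately have "C = 1 + fps_const a * fps_X * C + fps_const b * fps_X\<^sup>2 * C\<^sup>2"
    by simp
  then have "fps_nth C (Suc n) = fps_nth (1 + fps_const a * fps_X * C + fps_const b * fps_X\<^sup>2 * C\<^sup>2) (Suc n)"
    by simp
  also have "\<dots> = a * c n + b * (\<Sum>i<n. c i * c (n - Suc i))"
  proof (cases n)
    case 0
    then show ?thesis by (simp add: mult.assoc fps_X_power_mult_nth C_def)
  next
    case (Suc m)
    have "fps_nth (C\<^sup>2) m = (\<Sum>i<n. c i * c (n - Suc i))"
      by (simp add: power2_eq_square fps_mult_nth C_def Suc lessThan_Suc_atMost atLeast0AtMost)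
    then show ?thesis by (simp add: mult.assoc fps_X_power_mult_nth C_def Suc)
  qed
  finally show ?thesis by (simp add: C_def a_def b_def)
qed

text \<open>The atom at 0 affects only the zeroth moment, which is set to 1 so that one formula
  covers parameters below and above 1.\<close>

definition mp_moment :: "real \<Rightarrow> real \<Rightarrow> nat \<Rightarrow> real" where
  "mp_moment \<alpha> \<theta> n = (case n of 0 \<Rightarrow> 1
     | Suc k \<Rightarrow> arc_moment (\<alpha> * (1 - sqrt \<theta>)\<^sup>2) (\<alpha> * (1 + sqrt \<theta>)\<^sup>2) k / (2 * pi * \<alpha>))"

lemma free_poisson_endpoints:
  assumes "\<alpha> > 0" "\<theta> > 0"
  defines "A \<equiv> \<alpha> * (1 - sqrt \<theta>)\<^sup>2" and "B \<equiv> \<alpha> * (1 + sqrt \<theta>)\<^sup>2"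
  shows "A \<ge> 0" "A < B" "(A + B) / 2 = \<alpha> * (1 + \<theta>)" "B - A = 4 * \<alpha> * sqrt \<theta>"
    "A * B = (\<alpha> * (1 - \<theta>))\<^sup>2"
    "4 * \<theta> * \<alpha>\<^sup>2 - (x - \<alpha> * (1 + \<theta>))\<^sup>2 = (x - A) * (B - x)"
proof -
  have s: "sqrt \<theta> * sqrt \<theta> = \<theta>" using assms by simp
  define r where "r = sqrt \<theta>"
  have r: "\<theta> = r * r" "r > 0" using assms s by (simp_all add: r_def)
  have A: "A = \<alpha> * (1 - r)\<^sup>2" and B: "B = \<alpha> * (1 + r)\<^sup>2" by (simp_all add: A_def B_def r_def)
  show "A \<ge> 0" using assms by (simp add: A_def)
  show BA: "B - A = 4 * \<alpha> * sqrt \<theta>"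
    by (simp add: A B r_def[symmetric] power2_eq_square algebra_simps)
  then show "A < B" using assms by (metis diff_gt_0_iff_gt mult_pos_pos real_sqrt_gt_zero zero_less_numeral)
  show "(A + B) / 2 = \<alpha> * (1 + \<theta>)"
    by (simp add: A B r(1) power2_eq_square algebra_simps)
  show "A * B = (\<alpha> * (1 - \<theta>))\<^sup>2"
    by (simp add: A B r(1) power2_eq_square algebra_simps)
  show "4 * \<theta> * \<alpha>\<^sup>2 - (x - \<alpha> * (1 + \<theta>))\<^sup>2 = (x - A) * (B - x)"
    by (simp add: A B r(1) power2_eq_square algebra_simps)
qed

text \<open>Up to the factor \<alpha> \<theta>, the shifted moments are those of a semicircle law of
  mean \<alpha> (1 + \<theta>) and variance \<alpha>^2 \<theta>. The term k = 0 of the sum supplies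
  the difference between that mean and \<alpha> \<theta>.\<close>

lemma mp_moment_Suc:
  assumes "\<alpha> > 0" "\<theta> > 0"
  shows "mp_moment \<alpha> \<theta> (Suc n)
    = \<alpha> * \<theta> * mp_moment \<alpha> \<theta> n + \<alpha> * (\<Sum>k<n. mp_moment \<alpha> \<theta> k * mp_moment \<alpha> \<theta> (n - k))"
proof -
  define A B where "A = \<alpha> * (1 - sqrt \<theta>)\<^sup>2" and "B = \<alpha> * (1 + sqrt \<theta>)\<^sup>2"
  note ends = free_poisson_endpoints[OF assms, folded A_def B_def]
  define c where "c n = arc_moment A B n / arc_moment A B 0" for n
  have BA: "(B - A)\<^sup>2 = 16 * (\<alpha>\<^sup>2 * \<theta>)"
    unfolding ends(4) using assms by (simp add: power_mult_distrib)
  have I0: "arc_moment A B 0 = 2 * pi * \<alpha> * (\<alpha> * \<theta>)"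
    unfolding arc_moment_0[OF ends(2)] BA by (simp add: power2_eq_square)
  have mS: "mp_moment \<alpha> \<theta> (Suc k) = \<alpha> * \<theta> * c k" for k
    using assms by (simp add: mp_moment_def A_def[symmetric] B_def[symmetric] c_def I0)
  have m0: "mp_moment \<alpha> \<theta> 0 = 1" by (simp add: mp_moment_def)
  have c0: "c 0 = 1" using I0 assms by (simp add: c_def)
  show ?thesis
  proof (cases n)
    case 0
    then show ?thesis by (simp add: mS c0 m0)
  next
    case (Suc p)
    have c_Suc: "c (Suc p) = \<alpha> * (1 + \<theta>) * c p + \<alpha>\<^sup>2 * \<theta> * (\<Sum>i<p. c i * c (p - Suc i))"
      using arc_moment_convolution[OF ends(2), of p] unfolding c_def[symmetric] ends(3) BA by simp
    have "(\<Sum>k<n. mp_moment \<alpha> \<theta> k * mp_moment \<alpha> \<theta> (n - k))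
      = mp_moment \<alpha> \<theta> n + (\<Sum>i<p. mp_moment \<alpha> \<theta> (Suc i) * mp_moment \<alpha> \<theta> (p - i))"
      unfolding Suc by (subst sum.lessThan_Suc_shift) (simp add: m0)
    also have "(\<Sum>i<p. mp_moment \<alpha> \<theta> (Suc i) * mp_moment \<alpha> \<theta> (p - i))
      = (\<Sum>i<p. (\<alpha> * \<theta>)\<^sup>2 * (c i * c (p - Suc i)))"
    proof (rule sum.cong)
      fix i assume "i \<in> {..<p}"
      then have "p - i = Suc (p - Suc i)" by auto
      then show "mp_moment \<alpha> \<theta> (Suc i) * mp_moment \<alpha> \<theta> (p - i) = (\<alpha> * \<theta>)\<^sup>2 * (c i * c (p - Suc i))"
        by (simp only: mS power2_eq_square mult_ac)
    qed simp
    finally have "(\<Sum>k<n. mp_moment \<alpha> \<theta> k * mp_moment \<alpha> \<theta> (n - k))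
      = \<alpha> * \<theta> * c p + (\<alpha> * \<theta>)\<^sup>2 * (\<Sum>i<p. c i * c (p - Suc i))"
      by (simp only: sum_distrib_left Suc mS)
    then show ?thesis
      unfolding mS unfolding Suc mS c_Suc by (simp only:) (simp add: power2_eq_square algebra_simps)
  qed
qed

text \<open>Since f vanishes at 0, both measures may be restricted to the complement of 0, where
  they agree.\<close>

lemma nn_integral_free_poisson:
  assumes f: "f \<in> borel_measurable borel" and f0: "f 0 = 0"
  shows "(\<integral>\<^sup>+x. f x \<partial>free_poisson \<alpha> lam)
    = (\<integral>\<^sup>+x. ennreal (free_poisson_density \<alpha> lam x) * f x \<partial>lborel)"
proof -
  let ?M = "free_poisson \<alpha> lam" and ?\<rho> = "\<lambda>x. ennreal (free_poisson_density \<alpha> lam x)"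
  have rho: "?\<rho> \<in> borel_measurable lborel"
    unfolding free_poisson_density_def by measurable
  have M: "g \<in> borel_measurable ?M" if "g \<in> borel_measurable borel" for g :: "real \<Rightarrow> ennreal"
    using that measurable_cong_sets[OF sets_free_poisson refl] by blast
  have ind: "(indicator (- {0}) :: real \<Rightarrow> ennreal) \<in> borel_measurable ?M" by (rule M) simp
  have "density ?M (indicator (- {0})) = density lborel ?\<rho>"
  proof (rule measure_eqI)
    fix E assume "E \<in> sets (density ?M (indicator (- {0})))"
    then have E: "E \<in> sets borel" by simp
    have "emeasure (density ?M (indicator (- {0}))) E = emeasure ?M ((- {0}) \<inter> E)"
      using E by (intro emeasure_restricted) auto
    also have "\<dots> = (\<integral>\<^sup>+x. ?\<rho> x * indicator ((- {0}) \<inter> E) x \<partial>lborel)"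
      using E by (subst emeasure_free_poisson) auto
    also have "\<dots> = (\<integral>\<^sup>+x. ?\<rho> x * indicator E x \<partial>lborel)"
      by (rule nn_integral_cong_AE, rule eventually_mono[OF AE_lborel_singleton[of 0]])
        (auto simp: indicator_def)
    also have "\<dots> = emeasure (density lborel ?\<rho>) E"
      using E rho by (simp add: emeasure_density)
    finally show "emeasure (density ?M (indicator (- {0}))) E = emeasure (density lborel ?\<rho>) E" .
  qed simp
  then have "(\<integral>\<^sup>+x. f x \<partial>density ?M (indicator (- {0}))) = (\<integral>\<^sup>+x. f x \<partial>density lborel ?\<rho>)"
    by simp
  also have "\<dots> = (\<integral>\<^sup>+x. ?\<rho> x * f x \<partial>lborel)"
    using f by (intro nn_integral_density rho) simp
  also have "(\<integral>\<^sup>+x. f x \<partial>density ?M (indicator (- {0}))) = (\<integral>\<^sup>+x. indicator (- {0}) x * f x \<partial>?M)"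
    by (intro nn_integral_density ind M f)
  also have "\<dots> = (\<integral>\<^sup>+x. f x \<partial>?M)"
    by (intro nn_integral_cong) (auto simp: indicator_def f0)
  finally show ?thesis .
qed

lemma integral_free_poisson_power:
  assumes "\<alpha> > 0" "lam > 0"
  shows "(\<integral>t. t ^ Suc n \<partial>free_poisson \<alpha> lam) = mp_moment \<alpha> lam (Suc n)"
proof -
  define A B where "A = \<alpha> * (1 - sqrt lam)\<^sup>2" and "B = \<alpha> * (1 + sqrt lam)\<^sup>2"
  note ends = free_poisson_endpoints[OF assms, folded A_def B_def]
  define g where "g x = (if x \<in> {A..B} then x ^ n * sqrt ((x - A) * (B - x)) / (2 * pi * \<alpha>) else 0)" for x
  have density: "free_poisson_density \<alpha> lam x =
      (if x \<in> {A<..<B} then 1 / (2 * pi * \<alpha> * x) * sqrt ((x - A) * (B - x)) else 0)" for x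
    unfolding free_poisson_density_def A_def[symmetric] B_def[symmetric] ends(6) by simp
  have g_eq: "ennreal (free_poisson_density \<alpha> lam x) * ennreal (x ^ Suc n) = ennreal (g x)" for x
  proof (cases "x \<in> {A<..<B}")
    case True
    then have "x > 0" using ends(1) by auto
    then show ?thesis
      using True assms by (subst ennreal_mult'[symmetric]) (auto simp: density g_def mult_ac)
  next
    case False
    then have "g x = 0" by (auto simp: g_def)
    with False show ?thesis by (auto simp: density)
  qed
  have "((\<lambda>x. x ^ n * sqrt ((x - A) * (B - x)) / (2 * pi * \<alpha>)) has_integral
      arc_moment A B n / (2 * pi * \<alpha>)) {A..B}"
    using has_integral_mult_left[OF has_integral_arc_moment, of n A B "inverse (2 * pi * \<alpha>)"]
    by (simp only: divide_inverse)
  then have g_int: "(g has_integral arc_moment A B n / (2 * pi * \<alpha>)) UNIV"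
    unfolding g_def by (simp only: has_integral_restrict_UNIV)
  have g_nonneg: "g x \<ge> 0" for x
    using ends(1) assms by (auto simp: g_def)
  have "g \<in> borel_measurable borel" unfolding g_def by measurable
  then have "(\<integral>\<^sup>+x. g x \<partial>lborel) = arc_moment A B n / (2 * pi * \<alpha>)"
    by (rule nn_integral_has_integral_lborel[OF _ g_nonneg g_int])
  moreover have pow: "(\<lambda>x :: real. ennreal (x ^ Suc n)) \<in> borel_measurable borel" by measurable
  have "(\<integral>\<^sup>+x. ennreal (x ^ Suc n) \<partial>free_poisson \<alpha> lam) = (\<integral>\<^sup>+x. g x \<partial>lborel)"
    by (subst nn_integral_free_poisson[OF pow]) (simp, simp only: g_eq)
  \<comment> \<open>Odd powers are negative on the left half-line, so the passage to the nonnegative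
    integral needs that the law gives it no mass.\<close>
  moreover have AE: "AE x in free_poisson \<alpha> lam. 0 \<le> x ^ Suc n"
  proof -
    have "emeasure (free_poisson \<alpha> lam) {..<0} = 0"
    proof -
      have "ennreal (free_poisson_density \<alpha> lam x) * indicator {..<0} x = 0" for x
        using ends(1) by (auto simp: density indicator_def)
      then have "(\<integral>\<^sup>+x. ennreal (free_poisson_density \<alpha> lam x) * indicator {..<0} x \<partial>lborel)
          = (\<integral>\<^sup>+x. 0 \<partial>(lborel :: real measure))"
        by (simp only:)
      then show ?thesis by (subst emeasure_free_poisson) simp_all
    qed
    then have "{..<0 :: real} \<in> null_sets (free_poisson \<alpha> lam)" by (intro null_setsI) simp_all
    moreover have "x < 0" if "\<not> 0 \<le> x ^ Suc n" for x :: real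
      using that zero_le_power[of x "Suc n"] by linarith
    ultimately have "AE x in free_poisson \<alpha> lam. 0 \<le> x ^ Suc n"
      by (intro AE_I'[where N = "{..<0}"]) blast+
    then show ?thesis .
  qed
  moreover have "(\<lambda>x :: real. x ^ Suc n) \<in> borel_measurable (free_poisson \<alpha> lam)"
    using measurable_cong_sets[OF sets_free_poisson refl, of \<alpha> lam "borel :: real measure"]
    by (auto intro: borel_measurable_power)
  moreover have "arc_moment A B n \<ge> 0"
    unfolding arc_moment_def using ends(1)
    by (intro integral_nonneg integrable_continuous_real continuous_intros) auto
  ultimately show ?thesis
    using assms by (subst integral_eq_nn_integral) (auto simp: mp_moment_def A_def B_def)
qed

text \<open>For \<open>\<theta> > 1\<close> the law has no atom, so the moments, including the total mass, are integrals
  against the density.\<close>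

lemma has_integral_mp_moment:
  assumes "\<alpha> > 0" "\<theta> > 1"
  defines "A \<equiv> \<alpha> * (1 - sqrt \<theta>)\<^sup>2" and "B \<equiv> \<alpha> * (1 + sqrt \<theta>)\<^sup>2"
  shows "((\<lambda>x. x ^ n * (sqrt ((x - A) * (B - x)) / (2 * pi * \<alpha> * x))) has_integral mp_moment \<alpha> \<theta> n) {A..B}"
proof -
  have \<theta>: "\<theta> > 0" using assms by simp
  note ends = free_poisson_endpoints[OF assms(1) \<theta>, folded A_def B_def]
  have "sqrt \<theta> \<noteq> 1" using assms by simp
  then have A: "A > 0" using assms(1) by (simp add: A_def)
  have cancel: "y / x * inverse c = y / (c * x)" "z * y * inverse c = x * z * (y / (c * x))"
    if "x \<noteq> 0" for x y z c :: real
    using that by (cases "c = 0"; simp add: field_simps)+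
  show ?thesis
  proof (cases n)
    case 0
    have "sqrt (A * B) = \<alpha> * (\<theta> - 1)"
      unfolding ends(5) using assms by (simp add: abs_mult)
    then have mass: "(A + B) / 2 - sqrt (A * B) = 2 * \<alpha>"
      unfolding ends(3) by (simp add: algebra_simps)
    have "pi * (2 * \<alpha>) * inverse (2 * pi * \<alpha>) = mp_moment \<alpha> \<theta> n"
      using assms(1) by (simp add: mp_moment_def 0 divide_simps)
    then have "((\<lambda>x. sqrt ((x - A) * (B - x)) / x * inverse (2 * pi * \<alpha>)) has_integral
        mp_moment \<alpha> \<theta> n) {A..B}"
      using has_integral_mult_left[OF has_integral_arc_inverse[OF A ends(2)], of "inverse (2 * pi * \<alpha>)"]
      unfolding mass by (simp only:)
    then show ?thesis
      by (rule has_integral_eq[rotated]) (simp only: 0 power_0 mult_1, rule cancel(1), use A in auto)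
  next
    case (Suc k)
    have "mp_moment \<alpha> \<theta> n = arc_moment A B k * inverse (2 * pi * \<alpha>)"
      unfolding mp_moment_def Suc A_def B_def by (simp only: nat.case divide_inverse)
    then have "((\<lambda>x. x ^ k * sqrt ((x - A) * (B - x)) * inverse (2 * pi * \<alpha>)) has_integral
        mp_moment \<alpha> \<theta> n) {A..B}"
      using has_integral_mult_left[OF has_integral_arc_moment, of k A B "inverse (2 * pi * \<alpha>)"]
      by (simp only:)
    then show ?thesis
      by (rule has_integral_eq[rotated]) (simp only: Suc power_Suc, rule cancel(2), use A in auto)
  qed
qed

section \<open>Moments of free Poisson elements\<close>

context cstar_state
begin

lemma has_distribution_free_poisson_moment:
  assumes "has_distribution \<phi> x (free_poisson \<alpha> lam)" "\<alpha> > 0" "lam > 0"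
  shows "\<phi> (x ^ n) = of_real (mp_moment \<alpha> lam n)"
proof (cases n)
  case 0
  then show ?thesis by (simp add: phi_one mp_moment_def)
next
  case (Suc m)
  have "\<phi> (x ^ Suc m) = of_real (\<integral>t. t ^ Suc m \<partial>free_poisson \<alpha> lam)"
    using assms(1) unfolding has_distribution_def by blast
  then show ?thesis unfolding Suc integral_free_poisson_power[OF assms(2,3)] .
qed

text \<open>On polynomials in V, \<phi> is integration against a density of mass 1 on an interval
  with centre \<alpha> (1 + \<theta>) and half-width 2 \<alpha> sqrt \<theta>.\<close>

lemma mp_moment_growth:
  assumes moments: "\<And>n. \<phi> (V ^ n) = of_real (mp_moment \<alpha> \<theta> n)" and "\<alpha> > 0" "\<theta> > 1"
  shows "Re (\<phi> ((V - of_real (\<alpha> * (1 + \<theta>))) ^ (2 * n))) \<le> 1 * ((2 * \<alpha> * sqrt \<theta>)\<^sup>2) ^ n"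
proof -
  define A B where "A = \<alpha> * (1 - sqrt \<theta>)\<^sup>2" and "B = \<alpha> * (1 + sqrt \<theta>)\<^sup>2"
  define a where "a = \<alpha> * (1 + \<theta>)"
  define r where "r = 2 * \<alpha> * sqrt \<theta>"
  have \<theta>: "\<theta> > 0" using assms by simp
  note ends = free_poisson_endpoints[OF assms(2) \<theta>, folded A_def B_def]
  have "sqrt \<theta> \<noteq> 1" using assms by simp
  then have A: "A > 0" using assms(2) by (simp add: A_def)
  define \<rho> where "\<rho> x = sqrt ((x - A) * (B - x)) / (2 * pi * \<alpha> * x)" for x
  have \<rho>_nonneg: "\<rho> x \<ge> 0" if "x \<in> {A..B}" for x
    using that A assms by (simp add: \<rho>_def)
  have int: "(\<lambda>x. x ^ j * (x - a) ^ N * \<rho> x) integrable_on {A..B}" for j N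
    unfolding \<rho>_def using A assms by (intro integrable_continuous_real continuous_intros) auto
  \<comment> \<open>Mixed moments replace a binomial expansion: one factor x - a is absorbed at a
    time, by the same rule as for \<phi>.\<close>
  define J where "J j N = integral {A..B} (\<lambda>x. x ^ j * (x - a) ^ N * \<rho> x)" for j N
  have J0: "J n 0 = mp_moment \<alpha> \<theta> n" for n
    using has_integral_mp_moment[OF assms(2,3), of n]
    by (simp add: J_def \<rho>_def A_def B_def integral_unique)
  have J_Suc: "J j (Suc N) = J (Suc j) N - a * J j N" for j N
  proof -
    have "J j (Suc N) = integral {A..B} (\<lambda>x. x ^ Suc j * (x - a) ^ N * \<rho> x - a * (x ^ j * (x - a) ^ N * \<rho> x))"
      unfolding J_def by (rule integral_cong) (simp add: algebra_simps)
    also have "\<dots> = J (Suc j) N - integral {A..B} (\<lambda>x. a * (x ^ j * (x - a) ^ N * \<rho> x))"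
      unfolding J_def by (intro integral_diff int integrable_on_mult_right)
    also have "integral {A..B} (\<lambda>x. a * (x ^ j * (x - a) ^ N * \<rho> x)) = a * J j N"
      unfolding J_def by (rule integral_mult_right)
    finally show ?thesis .
  qed
  have "\<phi> (V ^ j * (V - of_real a) ^ N) = of_real (J j N)" for j N
  proof (induction N arbitrary: j)
    case 0
    then show ?case by (simp add: J0 moments)
  next
    case (Suc N)
    have "V ^ j * (V - of_real a) ^ Suc N
      = V ^ Suc j * (V - of_real a) ^ N - scaleR a (V ^ j * (V - of_real a) ^ N)"
      by (simp add: left_diff_distrib right_diff_distrib mult.assoc[symmetric] power_commutes
          of_real_def)
    then show ?case
      unfolding J_Suc by (simp add: phi_diff phi_scaleR Suc del: power_Suc)
  qed
  from this[of 0 "2 * n"] have "Re (\<phi> ((V - of_real a) ^ (2 * n))) = J 0 (2 * n)" by simp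
  also have "\<dots> \<le> integral {A..B} (\<lambda>x. (r\<^sup>2) ^ n * (x ^ 0 * (x - a) ^ 0 * \<rho> x))"
    unfolding J_def
  proof (rule integral_le[OF int integrable_on_mult_right[OF int]])
    fix x assume x: "x \<in> {A..B}"
    then have "\<bar>x - a\<bar> \<le> r" using ends(3,4) by (auto simp: a_def r_def abs_le_iff field_simps)
    then have "\<bar>x - a\<bar>\<^sup>2 \<le> r\<^sup>2" by (intro power_mono) auto
    then have "(x - a)\<^sup>2 \<le> r\<^sup>2" by simp
    then have "((x - a)\<^sup>2) ^ n \<le> (r\<^sup>2) ^ n" by (rule power_mono) simp
    then show "x ^ 0 * (x - a) ^ (2 * n) * \<rho> x \<le> (r\<^sup>2) ^ n * (x ^ 0 * (x - a) ^ 0 * \<rho> x)"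
      using \<rho>_nonneg[OF x] by (simp add: power_mult mult_right_mono)
  qed
  also have "\<dots> = (r\<^sup>2) ^ n * J 0 0"
    unfolding J_def by (rule integral_mult_right)
  also have "J 0 0 = 1" by (simp add: J0 mp_moment_def)
  finally show ?thesis by (simp add: a_def r_def)
qed

end

section \<open>The Lukacs property\<close>

context cstar_state
begin

lemma schwinger_dyson_power:
  fixes g :: "bool \<Rightarrow> 'a"
  assumes words: "\<And>ws. schwinger_dyson V \<beta> \<alpha> (tprod (map (letter g UNIV) ws))"
    and V: "V = g True + g False"
  shows "\<phi> (V ^ Suc n) = \<beta> * \<phi> (V ^ n) + \<alpha> * (\<Sum>k<n. \<phi> (V ^ k) * \<phi> (V ^ (n - k)))"
proof -
  define E where "E = range (letter g UNIV)"
  \<comment> \<open>As D V = \<open>1 \<otimes> V\<close>, the sum of the two letters is itself a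
    single letter, and the formula for powers of a letter applies.\<close>
  define v where "v = letter (\<lambda>_ :: unit. V) UNIV ()"
  have "v = tadd (letter g UNIV True) (letter g UNIV False)"
    by (rule tder_eqI) (simp_all add: v_def V snd_letter distrib_right distrib_left phi_add)
  then have "v \<in> talg E"
    by (auto simp: E_def intro: talg.add talg_generator)
  moreover have E: "bilinear_form (snd e)" if "e \<in> E" for e
    using that by (auto simp: E_def bilinear_letter)
  ultimately have "tprod (replicate n v) \<in> talg E"
    by (intro talg_tprod) auto
  then have "schwinger_dyson V \<beta> \<alpha> (tprod (replicate n v))"
  proof (rule schwinger_dyson_talg[OF _ E])
    fix ws assume "set ws \<subseteq> E"
    then have "\<exists>vs. ws = map (letter g UNIV) vs"
      by (induction ws) (auto simp: E_def intro: exI[of _ "_ # _"])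
    then show "schwinger_dyson V \<beta> \<alpha> (tprod ws)" using words by auto
  qed
  then show ?thesis
    by (simp add: schwinger_dyson_def v_def tprod_replicate)
qed

end

theorem theorem5p1:
  fixes \<phi> :: "'a::cstar_algebra \<Rightarrow> complex"
    and X Y :: 'a
    and \<alpha> lam \<kappa> :: real
  assumes "state \<phi>" and "faithful \<phi>" and "tracial \<phi>"
    and "\<alpha> > 0" and "lam > 0" and "\<kappa> > 0" and "lam + \<kappa> > 1"
    and "selfadjoint X" and "selfadjoint Y"
    and "free_pair \<phi> X Y"
    and "has_distribution \<phi> X (free_poisson \<alpha> lam)"
    and "has_distribution \<phi> Y (free_poisson \<alpha> \<kappa>)"
  shows "free_pair \<phi> (cstar_inv_sqrt (X + Y) * X * cstar_inv_sqrt (X + Y)) (X + Y)"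
proof -
  interpret faithful_tracial_state \<phi>
    by unfold_locales (rule assms)+
  define V where "V = X + Y"
  define g where "g i = (if i then X else Y)" for i
  define \<theta> where "\<theta> = lam + \<kappa>"
  have \<theta>: "\<theta> > 1" using assms by (simp add: \<theta>_def)
  have V: "V = g True + g False" by (simp add: g_def V_def)
  have free: "free_family \<phi> UNIV (\<lambda>i. unital_subalgebra hull {g i})"
    using assms(10) by (simp add: free_pair_def g_def if_distrib[of "\<lambda>x. unital_subalgebra hull {x}"])
  have sd: "schwinger_dyson (g i) (complex_of_real (\<alpha> * l)) \<alpha> (tprod (map (letter g {i}) ws))"
    if "has_distribution \<phi> (g i) (free_poisson \<alpha> l)" "l > 0" for i l ws
  proof (rule free_imp_schwinger_dyson[OF free])
    fix n
    show "\<phi> (g i ^ Suc n) = complex_of_real (\<alpha> * l) * \<phi> (g i ^ n)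
        + complex_of_real \<alpha> * (\<Sum>k<n. \<phi> (g i ^ k) * \<phi> (g i ^ (n - k)))"
      unfolding has_distribution_free_poisson_moment[OF that(1) \<open>\<alpha> > 0\<close> that(2)]
        mp_moment_Suc[OF \<open>\<alpha> > 0\<close> that(2)]
      by simp
  qed
  have sd_V: "schwinger_dyson V (complex_of_real (\<alpha> * \<theta>)) \<alpha> (tprod (map (letter g UNIV) ws))" for ws
  proof -
    have "has_distribution \<phi> (g True) (free_poisson \<alpha> lam)"
      "has_distribution \<phi> (g False) (free_poisson \<alpha> \<kappa>)"
      using assms by (simp_all add: g_def)
    from schwinger_dyson_sum[OF sd[OF this(1) \<open>lam > 0\<close>] sd[OF this(2) \<open>\<kappa> > 0\<close>], of ws]
    show ?thesis by (simp only: V \<theta>_def distrib_left of_real_add)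
  qed
  \<comment> \<open>V has the moments of the free Poisson law with parameters \<alpha> and \<theta>:
    both sequences start at 1 and obey the same recursion.\<close>
  have moments: "\<phi> (V ^ n) = complex_of_real (mp_moment \<alpha> \<theta> n)" for n
  proof (induction n rule: less_induct)
    case (less n)
    show ?case
    proof (cases n)
      case 0
      then show ?thesis by (simp add: phi_one mp_moment_def)
    next
      case (Suc m)
      have "(\<Sum>k<m. \<phi> (V ^ k) * \<phi> (V ^ (m - k)))
        = (\<Sum>k<m. complex_of_real (mp_moment \<alpha> \<theta> k * mp_moment \<alpha> \<theta> (m - k)))"
        by (intro sum.cong) (simp_all add: less Suc)
      moreover have "\<phi> (V ^ m) = complex_of_real (mp_moment \<alpha> \<theta> m)" by (rule less) (simp add: Suc)
      moreover have "\<theta> > 0" using \<theta> by simp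
      ultimately show ?thesis
        unfolding Suc schwinger_dyson_power[OF sd_V V] by (simp add: mp_moment_Suc[OF \<open>\<alpha> > 0\<close>])
    qed
  qed

  define a where "a = \<alpha> * (1 + \<theta>)"
  have a: "a > 0" using \<open>\<alpha> > 0\<close> \<theta> by (simp add: a_def)
  have sa: "selfadjoint V" unfolding V_def by (intro selfadjoint_add assms)
  have "norm (V - of_real a) \<le> 2 * \<alpha> * sqrt \<theta>"
  proof (rule norm_le_of_moment_growth)
    show "selfadjoint (V - of_real a)" by (intro selfadjoint_diff sa selfadjoint_of_real)
    show "2 * \<alpha> * sqrt \<theta> > 0" using \<open>\<alpha> > 0\<close> \<theta> by simp
    show "Re (\<phi> ((V - of_real a) ^ (2 * n))) \<le> 1 * ((2 * \<alpha> * sqrt \<theta>)\<^sup>2) ^ n" for n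
      unfolding a_def by (rule mp_moment_growth[OF moments \<open>\<alpha> > 0\<close> \<theta>])
  qed
  \<comment> \<open>The gap is the lower end point \<alpha> (1 - sqrt \<theta>)^2 of the
    support.\<close>
  also have "2 * \<alpha> * sqrt \<theta> < a"
  proof -
    have "0 < (1 - sqrt \<theta>)\<^sup>2" using \<theta> by simp
    also have "(1 - sqrt \<theta>)\<^sup>2 = 1 + \<theta> - 2 * sqrt \<theta>" using \<theta> by (simp add: power2_diff)
    finally have "\<alpha> * (2 * sqrt \<theta>) < \<alpha> * (1 + \<theta>)"
      using \<open>\<alpha> > 0\<close> by (intro mult_strict_left_mono) simp_all
    then show ?thesis by (simp add: a_def mult_ac)
  qed
  finally have "norm (V - of_real a) < a" .
  moreover have "1 - scaleR (1 / a) V = scaleR (- 1 / a) (V - of_real a)"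
    using a by (simp add: scaleR_diff_right of_real_def)
  ultimately have contraction: "norm (1 - scaleR (1 / a) V) < 1"
    using a by simp

  define S where "S = cstar_inv_sqrt V"
  \<comment> \<open>R is V^(1/2), written through S so that no further root is needed.\<close>
  define R where "R = V * S"
  have SSV: "S * S * V = 1" "V * (S * S) = 1"
    unfolding S_def by (rule cstar_inv_sqrt_mult[OF sa a contraction])+
  have RS: "R * S = 1" using SSV(2) by (simp add: R_def mult.assoc)
  have "R = V * S * (S * S * V)" by (simp add: SSV R_def)
  also have "\<dots> = V * (S * S) * (S * V)" by (simp only: mult.assoc)
  finally have R: "R = S * V" by (simp add: SSV)
  then have SR: "S * R = 1" using SSV(1) by (simp add: mult.assoc)

  \<comment> \<open>\<open>S * S\<close> is V^(-1), so \<open>g' True\<close> is W. The index set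
    \<open>{False}\<close> below says that D kills W and acts on V alone.\<close>
  define g' where "g' i = (if i then S * S * X else V)" for i
  have "schwinger_dyson V (complex_of_real (\<alpha> * \<theta>)) \<alpha> (tprod (map (letter g' {False}) ws))" for ws
    by (rule schwinger_dyson_inverse_mult[OF sd_V V a contraction SSV]) (simp_all add: g'_def g_def)
  then have "free_family \<phi> UNIV (\<lambda>i. unital_subalgebra hull {g' i})"
    by (intro schwinger_dyson_imp_free[of g' False]) (simp add: g'_def)
  then have "free_family \<phi> UNIV (\<lambda>i. unital_subalgebra hull {R * g' i * S})"
    by (rule free_family_conjugate[OF _ RS SR])
  moreover have "R * g' i * S = (if i then S * X * S else V)" for i
  proof (cases i)
    case True
    have "R * (S * S * X) * S = (R * S) * S * X * S" by (simp only: mult.assoc)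
    with True show ?thesis by (simp add: g'_def RS)
  next
    case False
    have "R * V * S = R * R" by (simp only: R_def mult.assoc)
    also have "\<dots> = V * (S * R)" by (simp add: R_def mult.assoc)
    finally show ?thesis using False by (simp add: g'_def SR)
  qed
  ultimately have "free_family \<phi> UNIV (\<lambda>i. unital_subalgebra hull {if i then S * X * S else V})"
    by simp
  then show ?thesis
    unfolding free_pair_def S_def V_def
    by (simp add: if_distrib[of "\<lambda>x. unital_subalgebra hull {x}"])
qed

end
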